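(* Let $k\ge1$ and $\diamond\in\{\prec,\succ,\prec',\succ'\}^k$. There exist an infinite plane bipartite graph $G_\diamond$ and a matching $\mathfrak{m}_\diamond$ of $G_\diamond$ such that the pure elements of $\mathcal{S}_\diamond$ are in bijection with the matchings of $G_\diamond$ that can be obtained from $\mathfrak{m}_\diamond$ by a finite sequence of flips, via a bijection $\phi$ such that, for each pure $\vec\lambda=(\lambda^{(0)},\dots,\lambda^{(k)})\in\mathcal{S}_\diamond$, the minimum number of flips needed to obtain $\phi(\vec\lambda)$ from $\mathfrak{m}_\diamond$ equals $\sum_{i=0}^k|\lambda^{(i)}|$.
   Context: For partitions, $\mu\prec\lambda$ ($\lambda\succ\mu$) means $\mu\subseteq\lambda$ (Young diagrams) and $\lambda/\mu$ is a horizontal strip (no two cells in a column); $\mu\prec'\lambda$ ($\lambda\succ'\mu$) means $\mu\subseteq\lambda$ and $\lambda/\mu$ is a vertical strip (no two cells in a row). $\mathcal{S}_\diamond$ is the set of sequences $(\lambda^{(0)},\dots,\lambda^{(k)})$ of partitions with $\lambda^{(i-1)}\diamond_i\lambda^{(i)}$ for all $1\le i\le k$; such a sequence is pure if $\lambda^{(0)}=\lambda^{(k)}=\emptyset$. A matching of a graph is a set of pairwise disjoint edges. Flip: if $f$ is a bounded face of a bipartite plane graph bordered by $2p$ edges ($p\ge1$), and $p$ of these edges belong to the matching, replace these $p$ edges by the other $p$ edges bordering $f$. *)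

theory Defs
  imports "HOL-Analysis.Analysis"
begin

section \<open>Partitions, strips and interlacing sequences\<close>

text \<open>A partition is its sequence of parts (largest first), padded with infinitely many zeros.\<close>

definition is_partition :: "(nat \<Rightarrow> nat) \<Rightarrow> bool" where
  "is_partition \<mu> \<longleftrightarrow> antimono \<mu> \<and> finite {i. \<mu> i \<noteq> 0}"

definition empty_partition :: "nat \<Rightarrow> nat" where
  "empty_partition = (\<lambda>_. 0)"

definition partition_size :: "(nat \<Rightarrow> nat) \<Rightarrow> nat" where
  "partition_size \<mu> = (\<Sum>i | \<mu> i \<noteq> 0. \<mu> i)"

text \<open>Cells are pairs (row, column).\<close>

definition young_diagram :: "(nat \<Rightarrow> nat) \<Rightarrow> (nat \<times> nat) set" where
  "young_diagram \<mu> = {(i, j). j < \<mu> i}"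

definition hstrip :: "(nat \<Rightarrow> nat) \<Rightarrow> (nat \<Rightarrow> nat) \<Rightarrow> bool" where
  "hstrip \<mu> \<nu> \<longleftrightarrow> young_diagram \<mu> \<subseteq> young_diagram \<nu> \<and>
     inj_on snd (young_diagram \<nu> - young_diagram \<mu>)"

definition vstrip :: "(nat \<Rightarrow> nat) \<Rightarrow> (nat \<Rightarrow> nat) \<Rightarrow> bool" where
  "vstrip \<mu> \<nu> \<longleftrightarrow> young_diagram \<mu> \<subseteq> young_diagram \<nu> \<and>
     inj_on fst (young_diagram \<nu> - young_diagram \<mu>)"

text \<open>The four symbols \<open>\<prec>\<close>, \<open>\<succ>\<close>, \<open>\<prec>'\<close>, \<open>\<succ>'\<close>, in this order.\<close>

datatype interlacing = Prec | Succ | Prec' | Succ'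

fun interlaces :: "interlacing \<Rightarrow> (nat \<Rightarrow> nat) \<Rightarrow> (nat \<Rightarrow> nat) \<Rightarrow> bool" where
  "interlaces Prec \<mu> \<nu> \<longleftrightarrow> hstrip \<mu> \<nu>"
| "interlaces Succ \<mu> \<nu> \<longleftrightarrow> hstrip \<nu> \<mu>"
| "interlaces Prec' \<mu> \<nu> \<longleftrightarrow> vstrip \<mu> \<nu>"
| "interlaces Succ' \<mu> \<nu> \<longleftrightarrow> vstrip \<nu> \<mu>"

definition interlacing_seqs :: "interlacing list \<Rightarrow> (nat \<Rightarrow> nat) list set" where
  "interlacing_seqs d = {ls. length ls = length d + 1 \<and> (\<forall>\<mu>\<in>set ls. is_partition \<mu>) \<and>
     (\<forall>i<length d. interlaces (d ! i) (ls ! i) (ls ! (i + 1)))}"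

definition pure_seqs :: "interlacing list \<Rightarrow> (nat \<Rightarrow> nat) list set" where
  "pure_seqs d =
     {ls \<in> interlacing_seqs d. hd ls = empty_partition \<and> last ls = empty_partition}"

section \<open>Plane graphs, faces, matchings and flips\<close>

text \<open>
  A plane graph is given by its set \<open>V\<close> of vertices, which are points of the plane, and its
  set \<open>E\<close> of edges, each of which is the point set of an arc joining two vertices. Edges meet only
  at vertices, and the drawing is locally finite: a bounded region meets only finitely many
  vertices and edges. Parallel edges are allowed (so a face may be bordered by two edges); the
  endpoints of an edge \<open>e\<close> are the two points of \<open>e \<inter> V\<close>.
\<close>

definition plane_graph :: "complex set \<Rightarrow> complex set set \<Rightarrow> bool" where
  "plane_graph V E \<longleftrightarrow>
     (\<forall>e\<in>E. \<exists>g. arc g \<and> path_image g = e \<and> e \<inter> V = {pathstart g, pathfinish g}) \<and>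
     (\<forall>e\<in>E. \<forall>e'\<in>E. e \<noteq> e' \<longrightarrow> e \<inter> e' \<subseteq> V) \<and>
     (\<forall>B. bounded B \<longrightarrow> finite (V \<inter> B) \<and> finite {e \<in> E. e \<inter> B \<noteq> {}})"

definition bipartite :: "complex set \<Rightarrow> complex set set \<Rightarrow> bool" where
  "bipartite V E \<longleftrightarrow>
     (\<exists>X Y. X \<union> Y = V \<and> X \<inter> Y = {} \<and> (\<forall>e\<in>E. \<exists>x\<in>X. \<exists>y\<in>Y. e \<inter> V = {x, y}))"

definition faces :: "complex set \<Rightarrow> complex set set \<Rightarrow> complex set set" where
  "faces V E = components (- (V \<union> \<Union>E))"

definition border :: "complex set set \<Rightarrow> complex set \<Rightarrow> complex set set" where
  "border E f = {e \<in> E. e \<subseteq> frontier f}"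

text \<open>As edges of a plane graph meet only at vertices, two edges are disjoint as point sets if and
  only if they have no common endpoint.\<close>

definition matching :: "complex set set \<Rightarrow> complex set set \<Rightarrow> bool" where
  "matching E M \<longleftrightarrow> M \<subseteq> E \<and> pairwise disjnt M"

text \<open>If \<open>f\<close> is bounded by a single cycle, then \<open>M'\<close> is automatically a matching.\<close>

definition flip :: "complex set \<Rightarrow> complex set set \<Rightarrow> complex set set \<Rightarrow> complex set set \<Rightarrow> bool" where
  "flip V E M M' \<longleftrightarrow> matching E M \<and> matching E M' \<and>
     (\<exists>f\<in>faces V E. \<exists>p\<ge>1. bounded f \<and> card (border E f) = 2 * p \<and>
        card (border E f \<inter> M) = p \<and> M' = (M - border E f) \<union> (border E f - M))"

definition flip_reachable :: "complex set \<Rightarrow> complex set set \<Rightarrow> complex set set \<Rightarrow> complex set set set" where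
  "flip_reachable V E M = {M'. (flip V E)\<^sup>*\<^sup>* M M'}"

text \<open>Only meaningful for \<open>M' \<in> flip_reachable V E M\<close>.\<close>

definition flip_distance :: "complex set \<Rightarrow> complex set set \<Rightarrow> complex set set \<Rightarrow> complex set set \<Rightarrow> nat" where
  "flip_distance V E M M' = (LEAST n. (flip V E ^^ n) M M')"

end

theory Submission
  imports Defs
begin

text \<open>
  Encode a partition by the numbers \<open>N(c)\<close> of parts whose bead \<open>\<mu>\<^sub>t - t\<close> exceeds the content \<open>c\<close>. A
  sequence becomes a height function \<open>N\<close> on pairs (index of the partition, content), and being
  partitions that interlace means exactly that \<open>N\<close> increases by \<open>0\<close> or \<open>1\<close> along certain pairs of
  neighbours. Take these pairs (index, content) as the faces and the neighbour relations as the edges of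
  a brick wall graph, and put an edge into the matching according to whether the increment across it is
  \<open>0\<close> or \<open>1\<close> (with the roles swapped for some edges, so that the graph is bipartite and at
  most one edge is chosen at each vertex). The matching edges alternate around a face exactly if \<open>N\<close> may
  be raised, respectively lowered, by one at this face, that is, if a box may be added to, respectively
  removed from, one of the partitions. So flips change the total size by one; as a nonempty sequence
  always has a removable box, every pure sequence is reached from the empty one in as many flips as
  it has boxes, and not faster.
\<close>

section \<open>Partitions and beads\<close>

text \<open>Where three faces meet, the increments across the three edges are related: one of them
  is the sum of the other two. As all are 0 or 1, replacing this one, a, by 1 - a makes the three
  add up to 1, so that a single edge is selected. On an unprimed line the exceptional edge is the
  one comparing adjacent contents of the two partitions; on a primed line it is the horizontal one.
  A horizontal edge between lines of different type would thus need opposite roles at its two ends.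
  This is why it is cut into halves there, and why a bounded face has six or eight edges. Only the
  partitions strictly between the two ends own bounded faces. The end partitions are fixed; their
  contents merge into two unbounded half-planes, where no flip takes place. Faces are by definition
  components of a complement in the plane. Drawing the graph with unit segments of the integer grid
  turns the bounded ones into open rectangles and reduces the topology to integer
  arithmetic.\<close>

lemma partition_antimono: "is_partition \<mu> \<Longrightarrow> s \<le> t \<Longrightarrow> \<mu> t \<le> \<mu> s"
  by (auto simp: is_partition_def antimono_def)

lemma partition_Suc_le: "is_partition \<mu> \<Longrightarrow> \<mu> (Suc t) \<le> \<mu> t"
  by (simp add: partition_antimono)

lemma is_partition_empty [simp]: "is_partition empty_partition"
  by (auto simp: is_partition_def empty_partition_def antimono_def)

lemma finite_support_upd:
  fixes \<mu> :: "nat \<Rightarrow> nat"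
  assumes "finite {i. \<mu> i \<noteq> 0}"
  shows "finite {i. (\<mu>(t := v)) i \<noteq> 0}"
  by (rule finite_subset[of _ "insert t {i. \<mu> i \<noteq> 0}"]) (use assms in auto)

lemma is_partition_upd:
  assumes "is_partition \<mu>" and "\<mu> (Suc t) \<le> v" and "\<And>s. t = Suc s \<Longrightarrow> v \<le> \<mu> s"
  shows "is_partition (\<mu>(t := v))"
proof -
  have "(\<mu>(t := v)) (Suc n) \<le> (\<mu>(t := v)) n" for n
    using assms partition_Suc_le[OF assms(1), of n] by auto
  then have "antimono (\<mu>(t := v))"
    by (rule decseq_SucI)
  moreover have "finite {i. (\<mu>(t := v)) i \<noteq> 0}"
    using assms(1) by (intro finite_support_upd) (simp add: is_partition_def)
  ultimately show ?thesis by (simp add: is_partition_def)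
qed

lemma partition_size_eq_sum:
  assumes "finite A" and "{i. \<mu> i \<noteq> 0} \<subseteq> A"
  shows "partition_size \<mu> = sum \<mu> A"
  unfolding partition_size_def by (rule sum.mono_neutral_left) (use assms in auto)

lemma partition_size_upd_Suc:
  assumes "is_partition \<mu>"
  shows "partition_size (\<mu>(t := Suc (\<mu> t))) = Suc (partition_size \<mu>)"
proof -
  define A where "A = insert t {i. \<mu> i \<noteq> 0}"
  have A: "finite A" "t \<in> A" using assms by (auto simp: A_def is_partition_def)
  have "partition_size (\<mu>(t := Suc (\<mu> t))) = sum (\<mu>(t := Suc (\<mu> t))) A"
    using A by (intro partition_size_eq_sum) (auto simp: A_def)
  also have "\<dots> = Suc (sum \<mu> A)"
    using A by (simp add: sum.remove[of A t])
  also have "sum \<mu> A = partition_size \<mu>"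
    using A by (intro partition_size_eq_sum[symmetric]) (auto simp: A_def)
  finally show ?thesis .
qed

section \<open>Strips as inequalities between parts\<close>

lemma young_diagram_subset_iff: "young_diagram \<mu> \<subseteq> young_diagram \<nu> \<longleftrightarrow> (\<forall>t. \<mu> t \<le> \<nu> t)"
proof
  assume *: "young_diagram \<mu> \<subseteq> young_diagram \<nu>"
  show "\<forall>t. \<mu> t \<le> \<nu> t"
  proof (rule allI, rule ccontr)
    fix t assume "\<not> \<mu> t \<le> \<nu> t"
    then have "(t, \<nu> t) \<in> young_diagram \<mu>" by (simp add: young_diagram_def)
    with * show False by (auto simp: young_diagram_def)
  qed
next
  assume "\<forall>t. \<mu> t \<le> \<nu> t"
  then show "young_diagram \<mu> \<subseteq> young_diagram \<nu>"
    by (auto simp: young_diagram_def intro: less_le_trans)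
qed

text \<open>If \<nu> (Suc t) exceeds \<mu> t, then column \<mu> t has new cells in both rows t and
  Suc t. Conversely, new cells of one column c in rows s < t would give c < \<nu> t \<le> \<nu> (Suc
  s) \<le> \<mu> s \<le> c.\<close>

lemma hstrip_iff:
  assumes \<mu>: "is_partition \<mu>" and \<nu>: "is_partition \<nu>"
  shows "hstrip \<mu> \<nu> \<longleftrightarrow> (\<forall>t. \<mu> t \<le> \<nu> t \<and> \<nu> (Suc t) \<le> \<mu> t)"
proof
  assume h: "hstrip \<mu> \<nu>"
  then have le: "\<And>t. \<mu> t \<le> \<nu> t" by (simp add: hstrip_def young_diagram_subset_iff)
  have "\<nu> (Suc t) \<le> \<mu> t" for t
  proof (rule ccontr)
    assume "\<not> \<nu> (Suc t) \<le> \<mu> t"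
    moreover have "\<nu> (Suc t) \<le> \<nu> t" "\<mu> (Suc t) \<le> \<mu> t"
      using \<mu> \<nu> by (simp_all add: partition_Suc_le)
    ultimately have "(t, \<mu> t) \<in> young_diagram \<nu> - young_diagram \<mu>"
      "(Suc t, \<mu> t) \<in> young_diagram \<nu> - young_diagram \<mu>"
      by (auto simp: young_diagram_def)
    with h show False using inj_onD[of snd _ "(t, \<mu> t)" "(Suc t, \<mu> t)"] by (auto simp: hstrip_def)
  qed
  with le show "\<forall>t. \<mu> t \<le> \<nu> t \<and> \<nu> (Suc t) \<le> \<mu> t" by blast
next
  assume h: "\<forall>t. \<mu> t \<le> \<nu> t \<and> \<nu> (Suc t) \<le> \<mu> t"
  have no: False if "s < t" "c < \<nu> t" "\<mu> s \<le> c" for s t c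
  proof -
    have "\<nu> t \<le> \<nu> (Suc s)" using \<nu> that(1) by (simp add: partition_antimono)
    with h that show False by (meson leD le_trans)
  qed
  have "inj_on snd (young_diagram \<nu> - young_diagram \<mu>)"
  proof (rule inj_onI)
    fix p q assume pq: "p \<in> young_diagram \<nu> - young_diagram \<mu>"
      "q \<in> young_diagram \<nu> - young_diagram \<mu>" "snd p = snd q"
    obtain s c t where "p = (s, c)" "q = (t, c)" using pq(3) by (metis prod.collapse)
    with pq no[of s t c] no[of t s c] show "p = q"
      by (cases s t rule: linorder_cases) (auto simp: young_diagram_def)
  qed
  with h show "hstrip \<mu> \<nu>" by (simp add: hstrip_def young_diagram_subset_iff)
qed

lemma vstrip_iff: "vstrip \<mu> \<nu> \<longleftrightarrow> (\<forall>t. \<mu> t \<le> \<nu> t \<and> \<nu> t \<le> Suc (\<mu> t))"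
proof
  assume h: "vstrip \<mu> \<nu>"
  then have le: "\<And>t. \<mu> t \<le> \<nu> t" by (simp add: vstrip_def young_diagram_subset_iff)
  have "\<nu> t \<le> Suc (\<mu> t)" for t
  proof (rule ccontr)
    assume "\<not> \<nu> t \<le> Suc (\<mu> t)"
    then have "(t, \<mu> t) \<in> young_diagram \<nu> - young_diagram \<mu>"
      "(t, Suc (\<mu> t)) \<in> young_diagram \<nu> - young_diagram \<mu>"
      by (auto simp: young_diagram_def)
    with h show False using inj_onD[of fst _ "(t, \<mu> t)" "(t, Suc (\<mu> t))"] by (auto simp: vstrip_def)
  qed
  with le show "\<forall>t. \<mu> t \<le> \<nu> t \<and> \<nu> t \<le> Suc (\<mu> t)" by blast
next
  assume h: "\<forall>t. \<mu> t \<le> \<nu> t \<and> \<nu> t \<le> Suc (\<mu> t)"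
  have "inj_on fst (young_diagram \<nu> - young_diagram \<mu>)"
  proof (rule inj_onI)
    fix p q assume pq: "p \<in> young_diagram \<nu> - young_diagram \<mu>"
      "q \<in> young_diagram \<nu> - young_diagram \<mu>" "fst p = fst q"
    obtain t c c' where "p = (t, c)" "q = (t, c')" using pq(3) by (metis prod.collapse)
    with pq h[rule_format, of t] show "p = q"
      by (auto simp: young_diagram_def)
  qed
  with h show "vstrip \<mu> \<nu>" by (simp add: vstrip_def young_diagram_subset_iff)
qed

text \<open>The positions \<mu> t - t form the Maya diagram of \<mu>. Counting beads beyond c is
  preferred to recording them because adding a box then changes a single value, and both kinds of
  strips become conditions on increments.\<close>

definition beads_above :: "(nat \<Rightarrow> nat) \<Rightarrow> int \<Rightarrow> int" where
  "beads_above \<mu> c = int (card {t. c < int (\<mu> t) - int t})"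

lemma bead_pos_le:
  assumes "is_partition \<mu>" and "s \<le> t"
  shows "int (\<mu> t) - int t \<le> int (\<mu> s) - int s"
  using partition_antimono[OF assms] assms(2) by linarith

lemma finite_beads:
  assumes "is_partition \<mu>"
  shows "finite {t. c < int (\<mu> t) - int t}"
proof (rule finite_subset)
  show "{t. c < int (\<mu> t) - int t} \<subseteq> {..nat (int (\<mu> 0) - c)}"
  proof
    fix t assume "t \<in> {t. c < int (\<mu> t) - int t}"
    moreover have "\<mu> t \<le> \<mu> 0" using assms by (simp add: partition_antimono)
    ultimately show "t \<in> {..nat (int (\<mu> 0) - c)}" by simp
  qed
qed simp

text \<open>Bead positions decrease with t, so the set being counted is an initial segment of the
  rows. The equivalence has the form of a Galois connection and transfers inequalities between rows
  and contents.\<close>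

lemma less_beads_above_iff:
  assumes "is_partition \<mu>"
  shows "int t < beads_above \<mu> c \<longleftrightarrow> c < int (\<mu> t) - int t"
proof -
  let ?A = "{t. c < int (\<mu> t) - int t}"
  have down: "s \<in> ?A" if "t \<in> ?A" "s \<le> t" for s t
    using bead_pos_le[OF assms that(2)] that(1) by simp
  show ?thesis
  proof
    assume "c < int (\<mu> t) - int t"
    then have "{..t} \<subseteq> ?A" using down by blast
    then have "card {..t} \<le> card ?A" by (intro card_mono finite_beads assms)
    then show "int t < beads_above \<mu> c" by (simp add: beads_above_def)
  next
    assume *: "int t < beads_above \<mu> c"
    show "c < int (\<mu> t) - int t"
    proof (rule ccontr)
      assume "\<not> ?thesis"
      then have "?A \<subseteq> {..<t}" using down by (metis (mono_tags, lifting) lessThan_iff mem_Collect_eq not_less subsetI)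
      then have "card ?A \<le> card {..<t}" by (intro card_mono) auto
      with * show False by (simp add: beads_above_def)
    qed
  qed
qed

lemma beads_above_nonneg: "0 \<le> beads_above \<mu> c"
  by (simp add: beads_above_def)

section \<open>Comparing partitions through their bead counts\<close>

lemma int_le_iff_nat_less:
  fixes a b :: int
  assumes "0 \<le> a" and "0 \<le> b"
  shows "a \<le> b \<longleftrightarrow> (\<forall>t. int t < a \<longrightarrow> int t < b)"
proof
  assume *: "\<forall>t. int t < a \<longrightarrow> int t < b"
  show "a \<le> b"
  proof (rule ccontr)
    assume "\<not> a \<le> b"
    then show False using *[rule_format, of "nat b"] assms by simp
  qed
qed auto

lemma int_le_iff_less:
  fixes a b :: int
  shows "a \<le> b \<longleftrightarrow> (\<forall>c. c < a \<longrightarrow> c < b)"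
  by (meson dual_order.strict_trans2 less_le_not_le linorder_le_less_linear)

text \<open>By \<open>less_beads_above_iff\<close> both sides become the same implication for all
  pairs of c and t; only the order of the quantifiers differs.\<close>

lemma beads_above_le_iff:
  assumes "is_partition \<mu>" "is_partition \<nu>"
  shows "(\<forall>c. beads_above \<mu> c \<le> beads_above \<nu> c) \<longleftrightarrow> (\<forall>t. \<mu> t \<le> \<nu> t)"
proof -
  have "(\<forall>c. beads_above \<mu> c \<le> beads_above \<nu> c) \<longleftrightarrow>
      (\<forall>c t. c < int (\<mu> t) - int t \<longrightarrow> c < int (\<nu> t) - int t)"
    by (simp add: int_le_iff_nat_less beads_above_nonneg less_beads_above_iff assms)
  also have "\<dots> \<longleftrightarrow> (\<forall>t. int (\<mu> t) - int t \<le> int (\<nu> t) - int t)"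
    by (subst all_comm) (simp only: int_le_iff_less)
  finally show ?thesis by simp
qed

lemma beads_above_le_shift_iff:
  assumes "is_partition \<mu>" "is_partition \<nu>"
  shows "(\<forall>c. beads_above \<nu> (c + 1) \<le> beads_above \<mu> c) \<longleftrightarrow> (\<forall>t. \<nu> t \<le> Suc (\<mu> t))"
proof -
  have "(\<forall>c. beads_above \<nu> (c + 1) \<le> beads_above \<mu> c) \<longleftrightarrow>
      (\<forall>c t. c < int (\<nu> t) - int t - 1 \<longrightarrow> c < int (\<mu> t) - int t)"
    by (simp add: int_le_iff_nat_less beads_above_nonneg less_beads_above_iff assms algebra_simps)
  also have "\<dots> \<longleftrightarrow> (\<forall>t. int (\<nu> t) - int t - 1 \<le> int (\<mu> t) - int t)"
    by (subst all_comm) (simp only: int_le_iff_less)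
  also have "\<dots> \<longleftrightarrow> (\<forall>t. \<nu> t \<le> Suc (\<mu> t))"
    by (intro all_cong1) linarith
  finally show ?thesis .
qed

text \<open>The summand 1 shifts the rows: it absorbs row 0 of \<nu>, and row Suc t of \<nu> is
  compared with row t of \<mu>.\<close>

lemma beads_above_le_Suc_iff:
  assumes "is_partition \<mu>" "is_partition \<nu>"
  shows "(\<forall>c. beads_above \<nu> c \<le> beads_above \<mu> (c + 1) + 1) \<longleftrightarrow> (\<forall>t. \<nu> (Suc t) \<le> \<mu> t)"
proof -
  have "beads_above \<nu> c \<le> beads_above \<mu> (c + 1) + 1 \<longleftrightarrow>
      (\<forall>t. c < int (\<nu> (Suc t)) - int t - 1 \<longrightarrow> c < int (\<mu> t) - int t - 1)" for c
  proof -
    have "beads_above \<nu> c \<le> beads_above \<mu> (c + 1) + 1 \<longleftrightarrow>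
      (\<forall>t. int t < beads_above \<nu> c \<longrightarrow> int t < beads_above \<mu> (c + 1) + 1)"
      by (rule int_le_iff_nat_less) (simp_all add: beads_above_nonneg add_nonneg_nonneg)
    also have "\<dots> \<longleftrightarrow> (\<forall>t. int (Suc t) < beads_above \<nu> c \<longrightarrow> int t < beads_above \<mu> (c + 1))"
    proof safe
      fix t assume *: "\<forall>t. int t < beads_above \<nu> c \<longrightarrow> int t < beads_above \<mu> (c + 1) + 1"
        and "int (Suc t) < beads_above \<nu> c"
      with *[rule_format, of "Suc t"] show "int t < beads_above \<mu> (c + 1)" by simp
    next
      fix t assume *: "\<forall>t. int (Suc t) < beads_above \<nu> c \<longrightarrow> int t < beads_above \<mu> (c + 1)"
        and "int t < beads_above \<nu> c"
      with *[rule_format, of "t - 1"] beads_above_nonneg[of \<mu> "c + 1"]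
      show "int t < beads_above \<mu> (c + 1) + 1" by (cases t) auto
    qed
    also have "\<dots> \<longleftrightarrow> (\<forall>t. c < int (\<nu> (Suc t)) - int t - 1 \<longrightarrow> c < int (\<mu> t) - int t - 1)"
      by (simp only: less_beads_above_iff assms) (simp add: algebra_simps)
    finally show ?thesis .
  qed
  then have "(\<forall>c. beads_above \<nu> c \<le> beads_above \<mu> (c + 1) + 1) \<longleftrightarrow>
    (\<forall>t c. c < int (\<nu> (Suc t)) - int t - 1 \<longrightarrow> c < int (\<mu> t) - int t - 1)"
    by (subst all_comm) (simp only:)
  also have "\<dots> \<longleftrightarrow> (\<forall>t. int (\<nu> (Suc t)) - int t - 1 \<le> int (\<mu> t) - int t - 1)"
    by (simp only: int_le_iff_less)
  also have "\<dots> \<longleftrightarrow> (\<forall>t. \<nu> (Suc t) \<le> \<mu> t)"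
    by (intro all_cong1) linarith
  finally show ?thesis .
qed

text \<open>The drop from c to c + 1 counts the beads at position c + 1, of which there is at most
  one. Formally, \<mu> is compared with itself.\<close>

lemma beads_above_step:
  assumes "is_partition \<mu>"
  shows "beads_above \<mu> (c + 1) \<le> beads_above \<mu> c" "beads_above \<mu> c \<le> beads_above \<mu> (c + 1) + 1"
  using beads_above_le_shift_iff[OF assms assms, THEN iffD2, rule_format, of c]
    beads_above_le_Suc_iff[OF assms assms, THEN iffD2, rule_format, of c]
    partition_Suc_le[OF assms] by simp_all

lemma beads_above_inject:
  assumes "is_partition \<mu>" "is_partition \<nu>" and "\<And>c. beads_above \<mu> c = beads_above \<nu> c"
  shows "\<mu> = \<nu>"
proof
  fix t
  show "\<mu> t = \<nu> t"
    using beads_above_le_iff[OF assms(1,2), THEN iffD1] beads_above_le_iff[OF assms(2,1), THEN iffD1]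
    by (simp add: assms(3) order_antisym)
qed

section \<open>Boxes as moves of a single bead\<close>

lemma beads_above_add_box:
  assumes "is_partition \<mu>"
  shows "beads_above (\<mu>(t := Suc (\<mu> t))) =
    (beads_above \<mu>)(int (\<mu> t) - int t := beads_above \<mu> (int (\<mu> t) - int t) + 1)"
proof
  fix c
  let ?A = "{t. c < int (\<mu> t) - int t}"
  have "{s. c < int ((\<mu>(t := Suc (\<mu> t))) s) - int s} =
      (if c = int (\<mu> t) - int t then insert t ?A else ?A)"
    by auto
  then show "beads_above (\<mu>(t := Suc (\<mu> t))) c =
    ((beads_above \<mu>)(int (\<mu> t) - int t := beads_above \<mu> (int (\<mu> t) - int t) + 1)) c"
    using finite_beads[OF assms] by (auto simp: beads_above_def)
qed

text \<open>The hypotheses say that position c holds a bead and c + 1 does not, so this bead can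
  jump one place to the right.\<close>

lemma ex_add_box:
  assumes \<mu>: "is_partition \<mu>"
    and "beads_above \<mu> (c + 1) = beads_above \<mu> c" "beads_above \<mu> (c - 1) = beads_above \<mu> c + 1"
  obtains \<nu> where "is_partition \<nu>" "beads_above \<nu> = (beads_above \<mu>)(c := beads_above \<mu> c + 1)"
    "partition_size \<nu> = partition_size \<mu> + 1"
proof
  \<comment> \<open>As many beads as \<open>beads_above \<mu> c\<close> lie beyond c, so this is the
    index of the bead at c.\<close>
  define t where "t = nat (beads_above \<mu> c)"
  have t: "int t = beads_above \<mu> c" by (simp add: t_def beads_above_nonneg)
  have "\<not> c < int (\<mu> t) - int t" "c - 1 < int (\<mu> t) - int t"
    using less_beads_above_iff[OF \<mu>, of t c] less_beads_above_iff[OF \<mu>, of t "c - 1"] t assms(3)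
    by simp_all
  then have c: "c = int (\<mu> t) - int t" by simp
  have prev: "Suc (\<mu> t) \<le> \<mu> s" if "t = Suc s" for s
    using less_beads_above_iff[OF \<mu>, of s "c + 1"] that t assms(2) c by simp
  show "is_partition (\<mu>(t := Suc (\<mu> t)))"
    using \<mu> prev partition_Suc_le[OF \<mu>, of t] by (intro is_partition_upd) auto
  show "beads_above (\<mu>(t := Suc (\<mu> t))) = (beads_above \<mu>)(c := beads_above \<mu> c + 1)"
    using beads_above_add_box[OF \<mu>] c by simp
  show "partition_size (\<mu>(t := Suc (\<mu> t))) = partition_size \<mu> + 1"
    using partition_size_upd_Suc[OF \<mu>] by simp
qed

text \<open>Here c + 1 holds a bead and c does not. The bead at c + 1 has index
  \<open>beads_above \<mu> (c + 1)\<close> and jumps one place to the left.\<close>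

lemma ex_remove_box:
  assumes \<mu>: "is_partition \<mu>"
    and "beads_above \<mu> c = beads_above \<mu> (c + 1) + 1" "beads_above \<mu> (c - 1) = beads_above \<mu> c"
  obtains \<nu> where "is_partition \<nu>" "beads_above \<nu> = (beads_above \<mu>)(c := beads_above \<mu> c - 1)"
    "partition_size \<mu> = partition_size \<nu> + 1"
proof
  define t where "t = nat (beads_above \<mu> (c + 1))"
  have t: "int t = beads_above \<mu> (c + 1)" by (simp add: t_def beads_above_nonneg)
  have "\<not> c + 1 < int (\<mu> t) - int t" "c < int (\<mu> t) - int t"
    using less_beads_above_iff[OF \<mu>, of t c] less_beads_above_iff[OF \<mu>, of t "c + 1"] t assms(2)
    by simp_all
  then have c: "c = int (\<mu> t) - int t - 1" by simp
  have "\<not> c - 1 < int (\<mu> (Suc t)) - int (Suc t)"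
    using less_beads_above_iff[OF \<mu>, of "Suc t" "c - 1"] t assms(2,3) by simp
  with c have less: "\<mu> (Suc t) < \<mu> t" by simp
  define \<nu> where "\<nu> = \<mu>(t := \<mu> t - 1)"
  have \<mu>_eq: "\<mu> = \<nu>(t := Suc (\<nu> t))" using less by (auto simp: \<nu>_def fun_eq_iff)
  show "is_partition \<nu>" unfolding \<nu>_def
  proof (rule is_partition_upd[OF \<mu>])
    show "\<mu> (Suc t) \<le> \<mu> t - 1" using less by simp
    show "\<mu> t - 1 \<le> \<mu> s" if "t = Suc s" for s
      using partition_Suc_le[OF \<mu>, of s] that by simp
  qed
  then have "beads_above \<mu> = (beads_above \<nu>)(int (\<nu> t) - int t := beads_above \<nu> (int (\<nu> t) - int t) + 1)"
      "partition_size \<mu> = partition_size \<nu> + 1"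
    using beads_above_add_box partition_size_upd_Suc by (subst \<mu>_eq, simp)+
  moreover have "int (\<nu> t) - int t = c" using c less by (simp add: \<nu>_def)
  ultimately show "beads_above \<nu> = (beads_above \<mu>)(c := beads_above \<mu> c - 1)"
      "partition_size \<mu> = partition_size \<nu> + 1"
    by (simp_all add: fun_eq_iff)
qed

section \<open>Subgraphs of the square grid\<close>

definition hunit :: "int \<Rightarrow> int \<Rightarrow> complex set" where
  "hunit x y = {z. of_int x \<le> Re z \<and> Re z \<le> of_int x + 1 \<and> Im z = of_int y}"

definition vunit :: "int \<Rightarrow> int \<Rightarrow> complex set" where
  "vunit x y = {z. Re z = of_int x \<and> of_int y \<le> Im z \<and> Im z \<le> of_int y + 1}"

definition grid_edges :: "complex set set" where
  "grid_edges = {hunit x y |x y. True} \<union> {vunit x y |x y. True}"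

definition grid_point :: "int \<Rightarrow> int \<Rightarrow> complex" where
  "grid_point x y = Complex (of_int x) (of_int y)"

definition grid_vertices :: "complex set set \<Rightarrow> complex set" where
  "grid_vertices E = \<Union>E \<inter> {grid_point x y |x y. True}"

lemma grid_point_eq_iff [simp]: "grid_point x y = grid_point x' y' \<longleftrightarrow> x = x' \<and> y = y'"
  by (simp add: grid_point_def)

lemma grid_edges_cases [consumes 1, case_names hunit vunit]:
  assumes "e \<in> grid_edges"
  obtains x y where "e = hunit x y" | x y where "e = vunit x y"
  using assms by (auto simp: grid_edges_def)

lemma grid_point_in_hunit [simp]: "grid_point a b \<in> hunit x y \<longleftrightarrow> b = y \<and> (a = x \<or> a = x + 1)"
  by (auto simp: grid_point_def hunit_def)

lemma grid_point_in_vunit [simp]: "grid_point a b \<in> vunit x y \<longleftrightarrow> a = x \<and> (b = y \<or> b = y + 1)"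
  by (auto simp: grid_point_def vunit_def)

lemma hunit_eq_iff [simp]: "hunit x y = hunit x' y' \<longleftrightarrow> x = x' \<and> y = y'"
proof
  assume "hunit x y = hunit x' y'"
  then have "\<And>a b. grid_point a b \<in> hunit x y \<longleftrightarrow> grid_point a b \<in> hunit x' y'" by simp
  from this[of x y] this[of "x + 1" y] show "x = x' \<and> y = y'" by auto
qed simp

lemma vunit_eq_iff [simp]: "vunit x y = vunit x' y' \<longleftrightarrow> x = x' \<and> y = y'"
proof
  assume "vunit x y = vunit x' y'"
  then have "\<And>a b. grid_point a b \<in> vunit x y \<longleftrightarrow> grid_point a b \<in> vunit x' y'" by simp
  from this[of x y] this[of x "y + 1"] show "x = x' \<and> y = y'" by auto
qed simp

lemma hunit_neq_vunit [simp]: "hunit x y \<noteq> vunit x' y'" "vunit x' y' \<noteq> hunit x y"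
proof -
  have "grid_point x y \<in> hunit x y" "grid_point (x + 1) y \<in> hunit x y" by simp_all
  moreover have "\<not> (grid_point x y \<in> vunit x' y' \<and> grid_point (x + 1) y \<in> vunit x' y')" by auto
  ultimately show "hunit x y \<noteq> vunit x' y'" by metis
  then show "vunit x' y' \<noteq> hunit x y" by simp
qed

text \<open>The arc starts at the left or lower end, so that its two ends differ by 1 in exactly one
  coordinate, as the parity argument for bipartiteness requires.\<close>

lemma grid_edge_arc:
  assumes "e \<in> grid_edges"
  obtains g a b where "arc g" "path_image g = e" "pathstart g = grid_point a b"
    "pathfinish g = grid_point (a + 1) b \<or> pathfinish g = grid_point a (b + 1)"
    "\<forall>x y. grid_point x y \<in> e \<longleftrightarrow> grid_point x y \<in> {pathstart g, pathfinish g}"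
  using assms
proof (cases rule: grid_edges_cases)
  case (hunit x y)
  have "closed_segment (grid_point x y) (grid_point (x + 1) y) = hunit x y"
    by (auto simp: closed_segment_same_Im closed_segment_eq_real_ivl grid_point_def hunit_def)
  then show ?thesis
    using hunit by (intro that[of "linepath (grid_point x y) (grid_point (x + 1) y)" x y]) auto
next
  case (vunit x y)
  have "closed_segment (grid_point x y) (grid_point x (y + 1)) = vunit x y"
    by (auto simp: closed_segment_same_Re closed_segment_eq_real_ivl grid_point_def vunit_def)
  then show ?thesis
    using vunit by (intro that[of "linepath (grid_point x y) (grid_point x (y + 1))" x y]) auto
qed

lemma grid_vertices_Int_edge:
  assumes "e \<in> E"
  shows "e \<inter> grid_vertices E = {z \<in> e. \<exists>x y. z = grid_point x y}"
  using assms by (auto simp: grid_vertices_def)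

lemma grid_edges_Int:
  assumes "e \<in> grid_edges" "e' \<in> grid_edges" "e \<noteq> e'" "z \<in> e" "z \<in> e'"
  shows "\<exists>x y. z = grid_point x y"
proof -
  have hh: "\<exists>x y. z = grid_point x y"
    if "z \<in> hunit x y" "z \<in> hunit x' y'" "x < x'" for x y x' y'
  proof -
    have "real_of_int x' \<ge> of_int x + 1" using that(3) by linarith
    then have "z = grid_point x' y'" using that by (auto simp: hunit_def grid_point_def complex_eq_iff)
    then show ?thesis by blast
  qed
  have vv: "\<exists>x y. z = grid_point x y"
    if "z \<in> vunit x y" "z \<in> vunit x' y'" "y < y'" for x y x' y'
  proof -
    have "real_of_int y' \<ge> of_int y + 1" using that(3) by linarith
    then have "z = grid_point x' y'" using that by (auto simp: vunit_def grid_point_def complex_eq_iff)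
    then show ?thesis by blast
  qed
  have hv: "\<exists>x y. z = grid_point x y" if "z \<in> hunit x y" "z \<in> vunit x' y'" for x y x' y'
  proof -
    have "z = grid_point x' y" using that by (auto simp: hunit_def vunit_def grid_point_def complex_eq_iff)
    then show ?thesis by blast
  qed
  have hy: "y = y'" if "z \<in> hunit x y" "z \<in> hunit x' y'" for x y x' y'
    using that by (auto simp: hunit_def)
  have vx: "x = x'" if "z \<in> vunit x y" "z \<in> vunit x' y'" for x y x' y'
    using that by (auto simp: vunit_def)
  from assms(1,2) show ?thesis
  proof (elim grid_edges_cases)
    fix x y x' y' assume *: "e = hunit x y" "e' = hunit x' y'"
    then have "x \<noteq> x'" using assms hy by auto
    then show ?thesis using * assms hh by (cases x x' rule: linorder_cases) auto
  next
    fix x y x' y' assume *: "e = vunit x y" "e' = vunit x' y'"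
    then have "y \<noteq> y'" using assms vx by auto
    then show ?thesis using * assms vv by (cases y y' rule: linorder_cases) auto
  qed (use assms hv in auto)
qed

lemma plane_graph_grid:
  assumes E: "E \<subseteq> grid_edges"
  shows "plane_graph (grid_vertices E) E"
  unfolding plane_graph_def
proof (intro conjI ballI impI allI)
  fix e assume "e \<in> E"
  then have "e \<in> grid_edges" using E by blast
  then obtain g a b where g: "arc g" "path_image g = e" "pathstart g = grid_point a b"
    "pathfinish g = grid_point (a + 1) b \<or> pathfinish g = grid_point a (b + 1)"
    "\<forall>x y. grid_point x y \<in> e \<longleftrightarrow> grid_point x y \<in> {pathstart g, pathfinish g}"
    by (rule grid_edge_arc)
  have "e \<inter> grid_vertices E = {pathstart g, pathfinish g}"
    unfolding grid_vertices_Int_edge[OF \<open>e \<in> E\<close>] using g(3-5) by auto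
  with g(1,2) show "\<exists>g. arc g \<and> path_image g = e \<and> e \<inter> grid_vertices E = {pathstart g, pathfinish g}"
    by blast
next
  fix e e' assume "e \<in> E" "e' \<in> E" "e \<noteq> e'"
  then have "\<exists>x y. z = grid_point x y" if "z \<in> e" "z \<in> e'" for z
    using E that by (intro grid_edges_Int[of e e']) auto
  with \<open>e \<in> E\<close> show "e \<inter> e' \<subseteq> grid_vertices E"
    by (auto simp: grid_vertices_def)
next
  fix B :: "complex set" assume "bounded B"
  then obtain r where r: "\<And>z. z \<in> B \<Longrightarrow> cmod z \<le> r" by (auto simp: bounded_iff)
  \<comment> \<open>The additional 1 leaves room for edges that meet B but begin up to one unit
    outside it.\<close>
  define R where "R = \<lceil>r\<rceil> + 1"
  have R: "\<bar>Re z\<bar> \<le> of_int R - 1 \<and> \<bar>Im z\<bar> \<le> of_int R - 1" if "z \<in> B" for z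
    using r[OF that] abs_Re_le_cmod[of z] abs_Im_le_cmod[of z] unfolding R_def by linarith
  let ?I = "{-R..R} \<times> {-R..R}"
  have fin: "finite ?I" by simp
  have "grid_vertices E \<inter> B \<subseteq> (\<lambda>(x, y). grid_point x y) ` ?I"
  proof
    fix z assume z: "z \<in> grid_vertices E \<inter> B"
    then obtain x y where xy: "z = grid_point x y" by (auto simp: grid_vertices_def)
    have "(x, y) \<in> ?I" using R[of z] z xy by (auto simp: grid_point_def abs_le_iff)
    with xy show "z \<in> (\<lambda>(x, y). grid_point x y) ` ?I" by force
  qed
  then show "finite (grid_vertices E \<inter> B)" using fin finite_surj by blast
  have "{e \<in> E. e \<inter> B \<noteq> {}} \<subseteq> (\<lambda>(x, y). hunit x y) ` ?I \<union> (\<lambda>(x, y). vunit x y) ` ?I"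
  proof
    fix e assume e: "e \<in> {e \<in> E. e \<inter> B \<noteq> {}}"
    then obtain z where z: "z \<in> e" "z \<in> B" by blast
    from e E have "e \<in> grid_edges" by blast
    then show "e \<in> (\<lambda>(x, y). hunit x y) ` ?I \<union> (\<lambda>(x, y). vunit x y) ` ?I"
    proof (cases rule: grid_edges_cases)
      case (hunit x y)
      have "(x, y) \<in> ?I" using R[OF z(2)] z(1) hunit by (auto simp: hunit_def abs_le_iff)
      with hunit show ?thesis by force
    next
      case (vunit x y)
      have "(x, y) \<in> ?I" using R[OF z(2)] z(1) vunit by (auto simp: vunit_def abs_le_iff)
      with vunit show ?thesis by force
    qed
  qed
  then show "finite {e \<in> E. e \<inter> B \<noteq> {}}" using fin by (auto intro: finite_subset)
qed

text \<open>Chessboard colouring: a unit step changes the parity of x + y.\<close>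

lemma bipartite_grid:
  assumes E: "E \<subseteq> grid_edges"
  shows "bipartite (grid_vertices E) E"
proof -
  let ?V = "grid_vertices E"
  let ?X = "{z \<in> ?V. \<exists>x y. z = grid_point x y \<and> even (x + y)}"
  let ?Y = "{z \<in> ?V. \<exists>x y. z = grid_point x y \<and> odd (x + y)}"
  have "?X \<union> ?Y = ?V" by (auto simp: grid_vertices_def)
  moreover have "?X \<inter> ?Y = {}" by auto
  moreover have "\<exists>x\<in>?X. \<exists>y\<in>?Y. e \<inter> ?V = {x, y}" if "e \<in> E" for e
  proof -
    have "e \<in> grid_edges" using E that by blast
    then obtain g a b where g: "pathstart g = grid_point a b"
      "pathfinish g = grid_point (a + 1) b \<or> pathfinish g = grid_point a (b + 1)"
      "\<forall>x y. grid_point x y \<in> e \<longleftrightarrow> grid_point x y \<in> {pathstart g, pathfinish g}"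
      by (rule grid_edge_arc)
    obtain a' b' where g': "pathfinish g = grid_point a' b'" "odd (a' + b') \<longleftrightarrow> even (a + b)"
      using g(2) by fastforce
    have eV: "e \<inter> ?V = {grid_point a b, grid_point a' b'}"
      unfolding grid_vertices_Int_edge[OF that] using g(1,3) g'(1) by auto
    then have "grid_point a b \<in> ?V" "grid_point a' b' \<in> ?V" by blast+
    then show ?thesis
    proof (cases "even (a + b)")
      case True
      then have "grid_point a b \<in> ?X" "grid_point a' b' \<in> ?Y"
        using g' \<open>grid_point a b \<in> ?V\<close> \<open>grid_point a' b' \<in> ?V\<close> by auto
      with eV show ?thesis
        by (intro bexI[of _ "grid_point a b" ?X] bexI[of _ "grid_point a' b'" ?Y])
    next
      case False
      then have "grid_point a b \<in> ?Y" "grid_point a' b' \<in> ?X"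
        using g' \<open>grid_point a b \<in> ?V\<close> \<open>grid_point a' b' \<in> ?V\<close> by auto
      moreover have "e \<inter> ?V = {grid_point a' b', grid_point a b}" using eV by blast
      ultimately show ?thesis
        by (intro bexI[of _ "grid_point a' b'" ?X] bexI[of _ "grid_point a b" ?Y])
    qed
  qed
  ultimately have "?X \<union> ?Y = ?V \<and> ?X \<inter> ?Y = {} \<and> (\<forall>e\<in>E. \<exists>x\<in>?X. \<exists>y\<in>?Y. e \<inter> ?V = {x, y})"
    by (intro conjI ballI)
  then show ?thesis
    unfolding bipartite_def by (intro exI)
qed

section \<open>The graph of a sequence of symbols\<close>

fun primed :: "interlacing \<Rightarrow> bool" where
  "primed Prec \<longleftrightarrow> False" | "primed Succ \<longleftrightarrow> False" | "primed Prec' \<longleftrightarrow> True" | "primed Succ' \<longleftrightarrow> True"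

fun growing :: "interlacing \<Rightarrow> bool" where
  "growing Prec \<longleftrightarrow> True" | "growing Succ \<longleftrightarrow> False" | "growing Prec' \<longleftrightarrow> True" | "growing Succ' \<longleftrightarrow> False"

text \<open>Line \<open>j\<close> is the vertical line of the drawing that separates the faces of the \<open>j\<close>-th partition
  from those of its successor. An edge on it compares the two partitions at the same content
  (\<open>Same\<close>) or at adjacent contents (\<open>Cross\<close>); the edges \<open>Right\<close> and \<open>Left\<close> attached to it
  compare adjacent contents of one partition.\<close>

datatype edge_label = Right nat int | Left nat int | Same nat int | Cross nat int

fun edge_line :: "edge_label \<Rightarrow> nat" where
  "edge_line (Right j c) = j" | "edge_line (Left j c) = j"
| "edge_line (Same j c) = j" | "edge_line (Cross j c) = j"

context
  fixes d :: "interlacing list"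
begin

text \<open>This is the staggering of the bricks. On an ascending line the faces to the right sit
  one unit higher, so (Suc j, c) touches (j, c) and (j, c + 1); otherwise (j, c) touches (Suc j, c)
  and (Suc j, c + 1). These are the pairs compared by the interlacing conditions;
  \<open>Prec\<close> and \<open>Succ'\<close> ascend.\<close>

definition ascending :: "nat \<Rightarrow> bool" where
  "ascending j \<longleftrightarrow> growing (d ! j) \<noteq> primed (d ! j)"

primrec offset :: "nat \<Rightarrow> int" where
  "offset 0 = 0"
| "offset (Suc j) = offset j + (if ascending j then 1 else -1)"

text \<open>Between a primed and an unprimed line the horizontal edges are subdivided, since one line sees
  the beads and the other one the gaps between them; the column then has width \<open>2\<close>. Otherwise
  \<open>Right j c\<close> and \<open>Left (Suc j) c\<close> denote the same edge.\<close>

primrec xpos :: "nat \<Rightarrow> int" where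
  "xpos 0 = 0"
| "xpos (Suc j) = xpos j + (if primed (d ! j) = primed (d ! Suc j) then 1 else 2)"

text \<open>The ordinate of the centre of the face (i, c). Faces have height 2, and adjacent columns
  are shifted by 1.\<close>

definition height :: "nat \<Rightarrow> int \<Rightarrow> int" where
  "height i c = 2 * c + offset i"

text \<open>Horizontal edges occur only between two lines. Without them, the faces of each end
  partition merge into one unbounded half-plane.\<close>

fun edge_ok :: "edge_label \<Rightarrow> bool" where
  "edge_ok (Right j c) \<longleftrightarrow> Suc j < length d"
| "edge_ok (Left j c) \<longleftrightarrow> 0 < j \<and> j < length d"
| "edge_ok (Same j c) \<longleftrightarrow> j < length d"
| "edge_ok (Cross j c) \<longleftrightarrow> j < length d"

fun seg :: "edge_label \<Rightarrow> complex set" where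
  "seg (Right j c) = hunit (xpos j) (height (Suc j) c + 1)"
| "seg (Left j c) = hunit (xpos j - 1) (height j c + 1)"
| "seg (Same j c) = vunit (xpos j) (height j c - (if ascending j then 0 else 1))"
| "seg (Cross j c) = vunit (xpos j) (height j c + (if ascending j then 1 else 0))"

text \<open>The height at the face \<open>src e\<close> is required to exceed the one at \<open>tgt e\<close> by \<open>0\<close> or \<open>1\<close>.\<close>

fun src :: "edge_label \<Rightarrow> nat \<times> int" where
  "src (Right j c) = (Suc j, c)"
| "src (Left j c) = (j, c)"
| "src (Same j c) = (if growing (d ! j) then (Suc j, c) else (j, c))"
| "src (Cross j c) = (if ascending j then (Suc j, c) else (j, c))"

fun tgt :: "edge_label \<Rightarrow> nat \<times> int" where
  "tgt (Right j c) = (Suc j, c + 1)"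
| "tgt (Left j c) = (j, c + 1)"
| "tgt (Same j c) = (if growing (d ! j) then (j, c) else (Suc j, c))"
| "tgt (Cross j c) = (if ascending j then (j, c + 1) else (Suc j, c + 1))"

text \<open>Marks, among the three edges at a vertex, the one whose increment is the sum of the
  other two. A reversed edge is selected when its increment is 0, any other edge when it is
  1.\<close>

fun reversed :: "edge_label \<Rightarrow> bool" where
  "reversed (Right j c) = primed (d ! j)"
| "reversed (Left j c) = primed (d ! j)"
| "reversed (Same j c) = False"
| "reversed (Cross j c) = (\<not> primed (d ! j))"

definition graph_edges :: "complex set set" where
  "graph_edges = seg ` Collect edge_ok"

text \<open>Being bounded by lines j and Suc j, \<open>cell j c\<close> is the face (Suc j, c) of
  the height function; this shift by one persists below.\<close>

definition cell :: "nat \<Rightarrow> int \<Rightarrow> complex set" where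
  "cell j c = box (grid_point (xpos j) (height (Suc j) c - 1))
                  (grid_point (xpos (Suc j)) (height (Suc j) c + 1))"

lemma edge_ok_line: "edge_ok e \<Longrightarrow> edge_line e < length d"
  by (cases e) auto

lemma graph_edges_grid: "graph_edges \<subseteq> grid_edges"
proof
  fix x assume "x \<in> graph_edges"
  then obtain e where "x = seg e" by (auto simp: graph_edges_def)
  then show "x \<in> grid_edges" by (cases e) (auto simp: grid_edges_def)
qed

section \<open>Vertical lines and horizontal rungs of the drawing\<close>

lemma xpos_less: "i < j \<Longrightarrow> xpos i < xpos j"
  by (rule lift_Suc_mono_less) auto

lemma xpos_less_iff [simp]: "xpos i < xpos j \<longleftrightarrow> i < j"
  by (metis linorder_neqE_nat order.asym less_irrefl xpos_less)

lemma xpos_eq_iff [simp]: "xpos i = xpos j \<longleftrightarrow> i = j"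
  by (metis linorder_neqE_nat less_irrefl xpos_less)

lemma xpos_le_iff [simp]: "xpos i \<le> xpos j \<longleftrightarrow> i \<le> j"
  by (simp add: le_less)

lemma xpos_nonneg: "0 \<le> xpos j"
  by (induction j) auto

lemma xpos_succ_iff:
  "xpos j = xpos i + 1 \<longleftrightarrow> j = Suc i \<and> primed (d ! i) = primed (d ! Suc i)"
proof
  assume *: "xpos j = xpos i + 1"
  then have "i < j" using xpos_less_iff[of i j] by linarith
  moreover have "\<not> Suc i < j" using xpos_less[of "Suc i" j] xpos_less[of i "Suc i"] * by linarith
  ultimately have "j = Suc i" by simp
  with * show "j = Suc i \<and> primed (d ! i) = primed (d ! Suc i)" by (auto split: if_splits)
qed auto

text \<open>Different labels share a segment only as \<open>Right j c\<close> and
  \<open>Left (Suc j) c\<close> in a column of width 1; its two lines then have the same type, so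
  \<open>reversed\<close> agrees. \<open>Same\<close> and \<open>Cross\<close> on one line are
  separated by parity. Hence the selection of a segment does not depend on its label.\<close>

lemma seg_eqD:
  assumes "seg e = seg e'"
  shows "src e = src e'" "tgt e = tgt e'" "reversed e = reversed e'"
proof -
  have rl: "j' = Suc j \<and> c = c' \<and> primed (d ! j) = primed (d ! Suc j)"
    if "xpos j = xpos j' - 1" "height (Suc j) c = height j' c'" for j j' c c'
    using that xpos_succ_iff[of j' j] by (auto simp: height_def)
  have "src e = src e' \<and> tgt e = tgt e' \<and> reversed e = reversed e'"
  proof (cases e; cases e')
    fix j c j' c' assume "e = Right j c" "e' = Left j' c'"
    with assms rl[of j j' c c'] show ?thesis by auto
  next
    fix j c j' c' assume "e = Left j c" "e' = Right j' c'"
    with assms rl[of j' j c' c] show ?thesis by auto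
  next
    fix j c j' c' assume "e = Same j c" "e' = Cross j' c'"
    with assms show ?thesis by (auto simp: height_def split: if_splits) presburger+
  next
    fix j c j' c' assume "e = Cross j c" "e' = Same j' c'"
    with assms show ?thesis by (auto simp: height_def split: if_splits) presburger+
  qed (use assms in \<open>auto simp: height_def\<close>)
  then show "src e = src e'" "tgt e = tgt e'" "reversed e = reversed e'" by auto
qed

text \<open>An edge that touches line j may be labelled by the neighbouring line. The column then
  has width 1, and the coinciding label attached to line j can be taken instead.\<close>

lemma edge_on_line:
  assumes "edge_ok e" "z \<in> seg e" "Re z = of_int (xpos j)" "j < length d"
  obtains e' where "edge_ok e'" "seg e' = seg e" "edge_line e' = j"
proof (cases e)
  case (Right i c)
  then have "xpos i \<le> xpos j" "xpos j \<le> xpos i + 1" using assms(2,3) by (auto simp: hunit_def)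
  then consider "j = i" | "xpos j = xpos i + 1" using xpos_eq_iff[of i j] by linarith
  then show ?thesis
  proof cases
    case 2
    then have "j = Suc i" by (simp add: xpos_succ_iff)
    with 2 Right assms show ?thesis by (intro that[of "Left (Suc i) c"]) auto
  qed (use Right assms in \<open>auto intro!: that[of e]\<close>)
next
  case (Left i c)
  then have "xpos i - 1 \<le> xpos j" "xpos j \<le> xpos i" using assms(2,3) by (auto simp: hunit_def)
  then consider "j = i" | "xpos i = xpos j + 1" using xpos_eq_iff[of i j] by linarith
  then show ?thesis
  proof cases
    case 2
    then have "i = Suc j" by (simp add: xpos_succ_iff)
    with 2 Left assms show ?thesis by (intro that[of "Right j c"]) auto
  qed (use Left assms in \<open>auto intro!: that[of e]\<close>)
qed (use assms in \<open>auto simp: vunit_def intro!: that[of e]\<close>)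

lemma edge_between_lines:
  assumes "edge_ok e" "z \<in> seg e" "of_int (xpos j) < Re z" "Re z < of_int (xpos (Suc j))"
  obtains c where "e = Right j c \<or> e = Left (Suc j) c" "Im z = of_int (height (Suc j) c + 1)"
proof (cases e)
  case (Right i c)
  then have "xpos i < xpos (Suc j)" "xpos j < xpos i + 1"
    using assms(2-4) unfolding Right seg.simps hunit_def mem_Collect_eq by linarith+
  moreover have "xpos i + 1 \<le> xpos j" if "i < j" using xpos_less[OF that] by linarith
  ultimately have "i = j" by (simp only: xpos_less_iff) linarith
  with Right assms(2) show ?thesis by (intro that[of c]) (auto simp: hunit_def)
next
  case (Left i c)
  then have "xpos i - 1 < xpos (Suc j)" "xpos j < xpos i"
    using assms(2-4) unfolding Left seg.simps hunit_def mem_Collect_eq by linarith+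
  moreover have "xpos (Suc j) \<le> xpos i - 1" if "Suc j < i" using xpos_less[OF that] by linarith
  ultimately have "i = Suc j" by (simp only: xpos_less_iff) linarith
  with Left assms(2) show ?thesis by (intro that[of c]) (auto simp: hunit_def)
next
  case (Same i c)
  then have "xpos i < xpos (Suc j)" "xpos j < xpos i"
    using assms(2-4) unfolding Same seg.simps vunit_def mem_Collect_eq by linarith+
  then have False by (simp only: xpos_less_iff)
  then show ?thesis ..
next
  case (Cross i c)
  then have "xpos i < xpos (Suc j)" "xpos j < xpos i"
    using assms(2-4) unfolding Cross seg.simps vunit_def mem_Collect_eq by linarith+
  then have False by (simp only: xpos_less_iff)
  then show ?thesis ..
qed

text \<open>The unit segments \<open>Same\<close> and \<open>Cross\<close> alternate along a line
  and leave no gap.\<close>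

lemma line_covered:
  assumes "Re z = of_int (xpos j)" "j < length d"
  shows "z \<in> \<Union>graph_edges"
proof -
  define n where "n = \<lfloor>Im z\<rfloor>"
  have z: "z \<in> vunit (xpos j) n" using assms(1) unfolding vunit_def n_def by simp
  have "\<exists>c. vunit (xpos j) n = seg (Same j c) \<or> vunit (xpos j) n = seg (Cross j c)"
    by (auto simp: height_def) presburger+
  then obtain e where "vunit (xpos j) n = seg e" "edge_ok e"
    using assms(2) edge_ok.simps(3,4) by metis
  then show ?thesis using z by (auto simp: graph_edges_def)
qed

lemma rung_covered:
  assumes "Suc j < length d" "of_int (xpos j) \<le> Re z" "Re z \<le> of_int (xpos (Suc j))"
    "Im z = of_int (height (Suc j) c + 1)"
  shows "z \<in> \<Union>graph_edges"
proof -
  have "z \<in> seg (Right j c) \<or> z \<in> seg (Left (Suc j) c)"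
    using assms by (auto simp: hunit_def split: if_splits)
  moreover have "seg (Right j c) \<in> graph_edges" "seg (Left (Suc j) c) \<in> graph_edges"
    unfolding graph_edges_def by (rule imageI, use assms(1) in simp)+
  ultimately show ?thesis by blast
qed

section \<open>The faces: two half-planes and open rectangles\<close>

lemma in_cell_iff:
  "z \<in> cell j c \<longleftrightarrow> of_int (xpos j) < Re z \<and> Re z < of_int (xpos (Suc j)) \<and>
     of_int (height (Suc j) c) - 1 < Im z \<and> Im z < of_int (height (Suc j) c) + 1"
  by (auto simp: cell_def in_box_complex_iff grid_point_def)

lemma cell_disjoint_edges:
  assumes "z \<in> cell j c"
  shows "z \<notin> \<Union>graph_edges"
proof
  assume "z \<in> \<Union>graph_edges"
  then obtain e where "edge_ok e" "z \<in> seg e" by (auto simp: graph_edges_def)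
  then obtain c' where "Im z = of_int (height (Suc j) c' + 1)"
    using assms edge_between_lines[of e z j] by (auto simp: in_cell_iff)
  then have "height (Suc j) c - 1 < height (Suc j) c' + 1" "height (Suc j) c' + 1 < height (Suc j) c + 1"
    using assms unfolding in_cell_iff by linarith+
  then show False by (simp add: height_def) presburger
qed

lemma edges_Re_bounds:
  assumes "z \<in> \<Union>graph_edges"
  shows "0 \<le> Re z" "Re z \<le> of_int (xpos (length d - 1))"
proof -
  obtain e where e: "edge_ok e" "z \<in> seg e" using assms by (auto simp: graph_edges_def)
  have "0 \<le> Re z \<and> Re z \<le> of_int (xpos (length d - 1))"
  proof (cases e)
    case (Right j c)
    have "xpos j < xpos (length d - 1)" using e(1) Right by simp
    then show ?thesis using e(2) xpos_nonneg[of j] unfolding Right seg.simps hunit_def mem_Collect_eq by linarith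
  next
    case (Left j c)
    have "xpos j \<le> xpos (length d - 1)" using e(1) Left by auto
    moreover have "1 \<le> xpos j" using e(1) Left xpos_less[of 0 j] by simp
    ultimately show ?thesis using e(2) xpos_nonneg[of j] unfolding Left seg.simps hunit_def mem_Collect_eq by linarith
  next
    case (Same j c)
    have "xpos j \<le> xpos (length d - 1)" using e(1) Same by simp
    then show ?thesis using e(2) xpos_nonneg[of j] unfolding Same seg.simps vunit_def mem_Collect_eq by linarith
  next
    case (Cross j c)
    have "xpos j \<le> xpos (length d - 1)" using e(1) Cross by simp
    then show ?thesis using e(2) xpos_nonneg[of j] unfolding Cross seg.simps vunit_def mem_Collect_eq by linarith
  qed
  then show "0 \<le> Re z" "Re z \<le> of_int (xpos (length d - 1))" by simp_all
qed

lemma exists_column: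
  assumes "0 \<le> x" "x < real_of_int (xpos m)"
  shows "\<exists>j<m. of_int (xpos j) \<le> x \<and> x < of_int (xpos (Suc j))"
  using assms(2)
proof (induction m)
  case 0
  with assms(1) show ?case by simp
next
  case (Suc m)
  show ?case
  proof (cases "x < of_int (xpos m)")
    case True
    with Suc.IH show ?thesis using less_SucI by blast
  next
    case False
    with Suc.prems show ?thesis by (intro exI[of _ m]) auto
  qed
qed

lemma ex_cell:
  assumes "z \<notin> \<Union>graph_edges" "0 \<le> Re z" "Re z \<le> of_int (xpos (length d - 1))" "d \<noteq> []"
  obtains j c where "Suc j < length d" "z \<in> cell j c"
proof -
  have no: "Re z \<noteq> of_int (xpos j)" if "j < length d" for j
    using line_covered that assms(1) by blast
  have "0 < Re z" "Re z < of_int (xpos (length d - 1))"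
    using no[of 0] no[of "length d - 1"] assms by auto
  then obtain j where j: "j < length d - 1" "of_int (xpos j) \<le> Re z" "Re z < of_int (xpos (Suc j))"
    using exists_column[of "Re z" "length d - 1"] by auto
  then have "j < length d" and Suc_j: "Suc j < length d" by linarith+
  with j(2) have less: "of_int (xpos j) < Re z" using no[of j] by linarith
  \<comment> \<open>The solution of
    \<open>height (Suc j) c - 1 \<le> Im z < height (Suc j) c + 1\<close>.\<close>
  define c where "c = \<lfloor>(Im z - of_int (offset (Suc j)) + 1) / 2\<rfloor>"
  have c: "of_int (height (Suc j) c) - 1 \<le> Im z" "Im z < of_int (height (Suc j) c) + 1"
    using of_int_floor_le[of "(Im z - of_int (offset (Suc j)) + 1) / 2"]
      floor_correct[of "(Im z - of_int (offset (Suc j)) + 1) / 2"]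
    unfolding c_def[symmetric] height_def of_int_add of_int_mult by (simp_all del: offset.simps add: field_simps)
  have "Im z \<noteq> of_int (height (Suc j) (c - 1) + 1)"
    using rung_covered[OF Suc_j, of z "c - 1"] assms(1) j by (auto simp del: xpos.simps)
  then have "Im z \<noteq> of_int (height (Suc j) c) - 1" by (simp add: height_def)
  with c less j Suc_j show ?thesis
    by (intro that[of j c]) (auto simp: in_cell_iff simp del: xpos.simps)
qed

lemma cells_disjoint:
  assumes "z \<in> cell j c" "z \<in> cell j' c'"
  shows "j = j' \<and> c = c'"
proof -
  have "xpos j < xpos (Suc j')" "xpos j' < xpos (Suc j)"
    using assms unfolding in_cell_iff by linarith+
  then have "j = j'" by (simp only: xpos_less_iff)
  moreover from this have "z \<in> cell j c'" using assms(2) by simp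
  then have "height (Suc j) c - 1 < height (Suc j) c' + 1" "height (Suc j) c' - 1 < height (Suc j) c + 1"
    using assms(1) unfolding in_cell_iff by linarith+
  ultimately show ?thesis by (auto simp: height_def)
qed

text \<open>It suffices to split the complement into pairwise disjoint nonempty sets that are open
  and connected; half-planes and rectangles are convex.\<close>

lemma faces_graph:
  assumes "d \<noteq> []"
  shows "faces (grid_vertices graph_edges) graph_edges =
    {{z. Re z < 0}, {z. Re z > of_int (xpos (length d - 1))}} \<union> {cell j c |j c. Suc j < length d}"
    (is "_ = ?A")
proof -
  let ?L = "{z. Re z < 0}" and ?R = "{z. Re z > of_int (xpos (length d - 1))}"
  have "components (- \<Union>graph_edges) = ?A"
  proof (rule components_open_unique)
    have cell_sub: "0 < Re z \<and> Re z < of_int (xpos (length d - 1))"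
      if "Suc j < length d" "z \<in> cell j c" for j c z
    proof -
      have "xpos (Suc j) \<le> xpos (length d - 1)" using that(1) by (simp del: xpos.simps)
      then show ?thesis using that(2) xpos_nonneg[of j] unfolding in_cell_iff by linarith
    qed
    have LR: "0 \<le> xpos (length d - 1)" by (rule xpos_nonneg)
    then have LR': "real_of_int (xpos (length d - 1)) \<ge> 0" by simp
    show "pairwise disjnt ?A"
      unfolding pairwise_def disjnt_def
    proof (intro ballI impI)
      fix X Y assume XY: "X \<in> ?A" "Y \<in> ?A" "X \<noteq> Y"
      have which: "Re z < 0 \<and> Z = ?L \<or> Re z > of_int (xpos (length d - 1)) \<and> Z = ?R \<or>
          0 < Re z \<and> Re z < of_int (xpos (length d - 1)) \<and> (\<exists>j c. z \<in> cell j c \<and> Z = cell j c)"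
        if "Z \<in> ?A" "z \<in> Z" for Z z
        using that cell_sub[of _ z] by blast
      have "X = Y" if "z \<in> X" "z \<in> Y" for z
        using which[OF XY(1) that(1)] which[OF XY(2) that(2)] LR'
      proof (elim disjE)
        assume "0 < Re z \<and> Re z < of_int (xpos (length d - 1)) \<and> (\<exists>j c. z \<in> cell j c \<and> X = cell j c)"
          "0 < Re z \<and> Re z < of_int (xpos (length d - 1)) \<and> (\<exists>j c. z \<in> cell j c \<and> Y = cell j c)"
        then show "X = Y" using cells_disjoint[of z] by metis
      qed auto
      with XY(3) show "X \<inter> Y = {}" by blast
    qed
    show "\<Union>?A = - \<Union>graph_edges"
    proof (intro equalityI subsetI)
      fix z assume "z \<in> \<Union>?A"
      then show "z \<in> - \<Union>graph_edges"
        using edges_Re_bounds[of z] cell_disjoint_edges[of z] by force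
    next
      fix z assume z: "z \<in> - \<Union>graph_edges"
      show "z \<in> \<Union>?A"
      proof (cases "z \<in> ?L \<union> ?R")
        case False
        then obtain j c where "Suc j < length d" "z \<in> cell j c"
          using ex_cell[of z] z assms by auto
        then show ?thesis by blast
      qed blast
    qed
    fix X assume "X \<in> ?A"
    then consider "X = ?L" | "X = ?R" | j c where "X = cell j c" "Suc j < length d" by blast
    then show "open X \<and> connected X \<and> X \<noteq> {}"
    proof cases
      case 1
      have "-1 \<in> ?L" by simp
      then have "?L \<noteq> {}" by blast
      with 1 show ?thesis
        by (simp add: open_halfspace_Re_lt convex_connected convex_halfspace_Re_lt del: Collect_empty_eq)
    next
      case 2
      have "of_int (xpos (length d - 1)) + 1 \<in> ?R" by simp
      then have "?R \<noteq> {}" by blast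
      with 2 show ?thesis
        by (simp add: open_halfspace_Re_gt convex_connected convex_halfspace_Re_gt del: Collect_empty_eq)
    next
      case 3
      have "xpos j < xpos (Suc j)" by (simp del: xpos.simps)
      then have "Complex ((of_int (xpos j) + of_int (xpos (Suc j))) / 2) (of_int (height (Suc j) c)) \<in> cell j c"
        by (simp add: in_cell_iff del: xpos.simps)
      then have "cell j c \<noteq> {}" by blast
      with 3 show ?thesis
        by (simp add: cell_def convex_connected open_box convex_box)
    qed
  qed
  moreover have "grid_vertices graph_edges \<union> \<Union>graph_edges = \<Union>graph_edges"
    by (auto simp: grid_vertices_def)
  ultimately show ?thesis by (simp add: faces_def)
qed

lemma bounded_faces_graph:
  assumes "d \<noteq> []"
  shows "{f \<in> faces (grid_vertices graph_edges) graph_edges. bounded f} = {cell j c |j c. Suc j < length d}"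
proof -
  have "\<not> bounded {z. Re z < 0}"
  proof
    assume "bounded {z. Re z < 0}"
    then obtain r where r: "\<And>z. Re z < 0 \<Longrightarrow> cmod z \<le> r" by (auto simp: bounded_iff)
    have "cmod (Complex (- \<bar>r\<bar> - 1) 0) \<le> r" by (intro r, unfold complex.sel) linarith
    with abs_Re_le_cmod[of "Complex (- \<bar>r\<bar> - 1) 0"] show False by simp
  qed
  moreover have "\<not> bounded {z. Re z > a}" for a
  proof
    assume "bounded {z. Re z > a}"
    then obtain r where r: "\<And>z. Re z > a \<Longrightarrow> cmod z \<le> r" by (auto simp: bounded_iff)
    have "cmod (Complex (\<bar>a\<bar> + \<bar>r\<bar> + 1) 0) \<le> r" by (intro r, unfold complex.sel) linarith
    with abs_Re_le_cmod[of "Complex (\<bar>a\<bar> + \<bar>r\<bar> + 1) 0"] show False by simp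
  qed
  moreover have "bounded (cell j c)" for j c by (simp add: cell_def bounded_box)
  ultimately show ?thesis unfolding faces_graph[OF assms] by auto
qed

section \<open>The edges that border a bounded face\<close>

lemma frontier_cell:
  "frontier (cell j c) = {z. of_int (xpos j) \<le> Re z \<and> Re z \<le> of_int (xpos (Suc j)) \<and>
     of_int (height (Suc j) c) - 1 \<le> Im z \<and> Im z \<le> of_int (height (Suc j) c) + 1 \<and>
     (Re z = of_int (xpos j) \<or> Re z = of_int (xpos (Suc j)) \<or>
      Im z = of_int (height (Suc j) c) - 1 \<or> Im z = of_int (height (Suc j) c) + 1)}"
proof -
  have "xpos j < xpos (Suc j)" by (simp del: xpos.simps)
  then have "Complex ((of_int (xpos j) + of_int (xpos (Suc j))) / 2) (of_int (height (Suc j) c)) \<in> cell j c"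
    by (simp add: in_cell_iff del: xpos.simps)
  then have "cell j c \<noteq> {}" by blast
  then have *: "frontier (cell j c) = cbox (grid_point (xpos j) (height (Suc j) c - 1))
     (grid_point (xpos (Suc j)) (height (Suc j) c + 1)) - cell j c"
    unfolding cell_def by (simp add: frontier_box)
  have key: "((a \<le> x \<and> x \<le> b) \<and> (p \<le> y \<and> y \<le> q)) \<and> \<not> (a < x \<and> x < b \<and> p < y \<and> y < q) \<longleftrightarrow>
      a \<le> x \<and> x \<le> b \<and> p \<le> y \<and> y \<le> q \<and> (x = a \<or> x = b \<or> y = p \<or> y = q)" for a b p q x y :: real
    by (auto simp: less_le)
  show ?thesis
    unfolding * by (rule set_eqI) (simp only: Diff_iff in_cbox_complex_iff in_cell_iff mem_Collect_eq
        grid_point_def complex.sel of_int_diff of_int_add of_int_1 atLeastAtMost_iff key)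
qed

text \<open>The unit segments of a line that border one face. \<open>lower_side\<close> and
  \<open>upper_side\<close> are seen from the face (Suc j, c) to the right of line j,
  \<open>lower_side'\<close> and \<open>upper_side'\<close> from the face (j, c) to its left; the
  staggering decides which label is which.\<close>

definition lower_side :: "nat \<Rightarrow> int \<Rightarrow> edge_label" where
  "lower_side j c = (if ascending j then Same j c else Cross j (c - 1))"

definition upper_side :: "nat \<Rightarrow> int \<Rightarrow> edge_label" where
  "upper_side j c = (if ascending j then Cross j c else Same j c)"

definition lower_side' :: "nat \<Rightarrow> int \<Rightarrow> edge_label" where
  "lower_side' j c = (if ascending j then Cross j (c - 1) else Same j c)"

definition upper_side' :: "nat \<Rightarrow> int \<Rightarrow> edge_label" where
  "upper_side' j c = (if ascending j then Same j c else Cross j c)"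

text \<open>In a column of width 1 the two halves of the top and of the bottom coincide, so these
  eight labels denote six segments.\<close>

definition cell_labels :: "nat \<Rightarrow> int \<Rightarrow> edge_label set" where
  "cell_labels j c = {Right j (c - 1), Right j c, Left (Suc j) (c - 1), Left (Suc j) c,
     lower_side j c, upper_side j c, lower_side' (Suc j) c, upper_side' (Suc j) c}"

lemma cell_labels_iff:
  "e \<in> cell_labels j c \<and> edge_ok e \<longleftrightarrow> edge_ok e \<and> (src e = (Suc j, c) \<or> tgt e = (Suc j, c))"
  if "Suc j < length d"
  using that
  by (cases e) (auto simp: cell_labels_def lower_side_def upper_side_def lower_side'_def upper_side'_def
      split: if_splits)

text \<open>For the forward direction the two end points are enough: both lie on the boundary of the
  rectangle, which restricts the line and the content to the labels listed.\<close>

lemma seg_subset_frontier_iff: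
  assumes "edge_ok e" "Suc j < length d"
  shows "seg e \<subseteq> frontier (cell j c) \<longleftrightarrow> e \<in> cell_labels j c"
proof
  assume sub: "seg e \<subseteq> frontier (cell j c)"
  have pt: "xpos j \<le> x \<and> x \<le> xpos (Suc j) \<and> height (Suc j) c - 1 \<le> y \<and> y \<le> height (Suc j) c + 1 \<and>
      (x = xpos j \<or> x = xpos (Suc j) \<or> y = height (Suc j) c - 1 \<or> y = height (Suc j) c + 1)"
    if "grid_point x y \<in> seg e" for x y
  proof -
    have "grid_point x y \<in> frontier (cell j c)" using that sub by blast
    then show ?thesis unfolding frontier_cell grid_point_def mem_Collect_eq complex.sel by linarith
  qed
  show "e \<in> cell_labels j c"
  proof (cases e)
    case (Right i c')
    then have *: "grid_point (xpos i) (height (Suc i) c' + 1) \<in> seg e"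
        "grid_point (xpos i + 1) (height (Suc i) c' + 1) \<in> seg e"
      by simp_all
    have "xpos j \<le> xpos i" "xpos i < xpos (Suc j)"
      using pt[OF *(1)] pt[OF *(2)] by linarith+
    then have "i = j" by (simp del: xpos.simps)
    with pt[OF *(1)] have "2 * c - 2 \<le> 2 * c'" "2 * c' \<le> 2 * c"
      by (simp_all add: height_def del: offset.simps)
    then have "c' = c \<or> c' = c - 1" by linarith
    with \<open>i = j\<close> show ?thesis using Right by (auto simp: cell_labels_def)
  next
    case (Left i c')
    then have *: "grid_point (xpos i - 1) (height i c' + 1) \<in> seg e"
        "grid_point (xpos i) (height i c' + 1) \<in> seg e"
      by simp_all
    have "xpos j < xpos i" "xpos i \<le> xpos (Suc j)"
      using pt[OF *(1)] pt[OF *(2)] by linarith+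
    then have "i = Suc j" by (simp del: xpos.simps)
    with pt[OF *(1)] have "2 * c - 2 \<le> 2 * c'" "2 * c' \<le> 2 * c"
      by (simp_all add: height_def del: offset.simps)
    then have "c' = c \<or> c' = c - 1" by linarith
    with \<open>i = Suc j\<close> show ?thesis using Left by (auto simp: cell_labels_def)
  next
    case (Same i c')
    define h where "h = height i c' - (if ascending i then 0 else 1)"
    have *: "grid_point (xpos i) h \<in> seg e" "grid_point (xpos i) (h + 1) \<in> seg e"
      using Same by (simp_all add: h_def)
    have "xpos j \<le> xpos i" "xpos i \<le> xpos (Suc j)" "height (Suc j) c - 1 \<le> h" "h \<le> height (Suc j) c"
      using pt[OF *(1)] pt[OF *(2)] by linarith+
    moreover from this(1,2) have "i = j \<or> i = Suc j" by (auto simp del: xpos.simps)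
    moreover have "h = height (Suc j) c - 1 \<or> h = height (Suc j) c" using calculation by linarith
    ultimately have "i = j \<or> i = Suc j" "h = height (Suc j) c - 1 \<or> h = height (Suc j) c" by auto
    then show ?thesis using Same
      by (elim disjE) (auto simp: cell_labels_def lower_side_def upper_side_def lower_side'_def
          upper_side'_def h_def height_def split: if_splits)
  next
    case (Cross i c')
    define h where "h = height i c' + (if ascending i then 1 else 0)"
    have *: "grid_point (xpos i) h \<in> seg e" "grid_point (xpos i) (h + 1) \<in> seg e"
      using Cross by (simp_all add: h_def)
    have "xpos j \<le> xpos i" "xpos i \<le> xpos (Suc j)" "height (Suc j) c - 1 \<le> h" "h \<le> height (Suc j) c"
      using pt[OF *(1)] pt[OF *(2)] by linarith+
    moreover from this(1,2) have "i = j \<or> i = Suc j" by (auto simp del: xpos.simps)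
    moreover have "h = height (Suc j) c - 1 \<or> h = height (Suc j) c" using calculation by linarith
    ultimately have "i = j \<or> i = Suc j" "h = height (Suc j) c - 1 \<or> h = height (Suc j) c" by auto
    then show ?thesis using Cross
      by (elim disjE) (auto simp: cell_labels_def lower_side_def upper_side_def lower_side'_def
          upper_side'_def h_def height_def split: if_splits)
  qed
next
  assume "e \<in> cell_labels j c"
  then show "seg e \<subseteq> frontier (cell j c)"
    unfolding cell_labels_def lower_side_def upper_side_def lower_side'_def upper_side'_def
    by (auto simp: frontier_cell hunit_def vunit_def height_def split: if_splits)
qed

lemma border_cell:
  assumes "Suc j < length d"
  shows "border graph_edges (cell j c) = seg ` cell_labels j c"
proof -
  have ok: "edge_ok e" if "e \<in> cell_labels j c" for e
    using that assms
    by (auto simp: cell_labels_def lower_side_def upper_side_def lower_side'_def upper_side'_def)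
  show ?thesis
    unfolding border_def graph_edges_def using seg_subset_frontier_iff[OF _ assms] ok by blast
qed

end

section \<open>Height functions and dimers\<close>

text \<open>The bits are sides in cyclic order. With half of them set and no two consecutive ones,
  only the two alternating patterns remain.\<close>

lemma alternating_6:
  assumes "of_bool b1 + of_bool b2 + of_bool b3 + of_bool b4 + of_bool b5 + of_bool b6 = (3::nat)"
    and "\<not> (b1 \<and> b2)" "\<not> (b2 \<and> b3)" "\<not> (b3 \<and> b4)" "\<not> (b4 \<and> b5)" "\<not> (b5 \<and> b6)" "\<not> (b6 \<and> b1)"
  shows "b2 = (\<not> b1) \<and> b3 = b1 \<and> b4 = (\<not> b1) \<and> b5 = b1 \<and> b6 = (\<not> b1)"
  using assms by (cases b1; cases b2; cases b3; cases b4; cases b5; cases b6) simp_all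

lemma alternating_8:
  assumes "of_bool b1 + of_bool b2 + of_bool b3 + of_bool b4 + of_bool b5 + of_bool b6
      + of_bool b7 + of_bool b8 = (4::nat)"
    and "\<not> (b1 \<and> b2)" "\<not> (b2 \<and> b3)" "\<not> (b3 \<and> b4)" "\<not> (b4 \<and> b5)" "\<not> (b5 \<and> b6)" "\<not> (b6 \<and> b7)"
      "\<not> (b7 \<and> b8)" "\<not> (b8 \<and> b1)"
  shows "b2 = (\<not> b1) \<and> b3 = b1 \<and> b4 = (\<not> b1) \<and> b5 = b1 \<and> b6 = (\<not> b1) \<and> b7 = b1 \<and> b8 = (\<not> b1)"
  using assms by (cases b1; cases b2; cases b3; cases b4; cases b5; cases b6; cases b7; cases b8) simp_all

lemma matching_meet:
  assumes "matching E M" "e \<in> M" "e' \<in> M" "z \<in> e" "z \<in> e'"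
  shows "e = e'"
  using assms unfolding matching_def pairwise_def disjnt_def by blast

lemma card_Int_eq_sum:
  assumes "finite B"
  shows "card (B \<inter> M) = (\<Sum>e\<in>B. of_bool (e \<in> M))"
  using assms by (simp add: of_bool_def sum.If_cases)

text \<open>The sides are listed counterclockwise from the bottom. Consecutive ones share a lattice
  point, so a matching never contains both.\<close>

lemma hexagon_alternating:
  assumes M: "matching E M"
    and B: "B = {hunit x (h - 1), vunit (x + 1) (h - 1), vunit (x + 1) h, hunit x (h + 1), vunit x h,
      vunit x (h - 1)}"
    and p: "card B = 2 * p" "card (B \<inter> M) = p"
  obtains b where "hunit x (h - 1) \<in> M \<longleftrightarrow> b" "vunit (x + 1) (h - 1) \<in> M \<longleftrightarrow> \<not> b"
    "vunit (x + 1) h \<in> M \<longleftrightarrow> b" "hunit x (h + 1) \<in> M \<longleftrightarrow> \<not> b" "vunit x h \<in> M \<longleftrightarrow> b"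
    "vunit x (h - 1) \<in> M \<longleftrightarrow> \<not> b"
proof -
  have "card B = 6" unfolding B by simp
  then have "card (B \<inter> M) = 3" using p by simp
  moreover have "card (B \<inter> M) = of_bool (hunit x (h - 1) \<in> M) + of_bool (vunit (x + 1) (h - 1) \<in> M)
    + of_bool (vunit (x + 1) h \<in> M) + of_bool (hunit x (h + 1) \<in> M) + of_bool (vunit x h \<in> M)
    + of_bool (vunit x (h - 1) \<in> M)"
    unfolding B by (subst card_Int_eq_sum) simp_all
  ultimately have sum: "of_bool (hunit x (h - 1) \<in> M) + of_bool (vunit (x + 1) (h - 1) \<in> M)
    + of_bool (vunit (x + 1) h \<in> M) + of_bool (hunit x (h + 1) \<in> M) + of_bool (vunit x h \<in> M)
    + of_bool (vunit x (h - 1) \<in> M) = (3::nat)" by simp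
  have adj: "\<not> (hunit x (h - 1) \<in> M \<and> vunit (x + 1) (h - 1) \<in> M)"
    "\<not> (vunit (x + 1) (h - 1) \<in> M \<and> vunit (x + 1) h \<in> M)"
    "\<not> (vunit (x + 1) h \<in> M \<and> hunit x (h + 1) \<in> M)"
    "\<not> (hunit x (h + 1) \<in> M \<and> vunit x h \<in> M)"
    "\<not> (vunit x h \<in> M \<and> vunit x (h - 1) \<in> M)"
    "\<not> (vunit x (h - 1) \<in> M \<and> hunit x (h - 1) \<in> M)"
    using matching_meet[OF M, of "hunit x (h - 1)" "vunit (x + 1) (h - 1)" "grid_point (x + 1) (h - 1)"]
      matching_meet[OF M, of "vunit (x + 1) (h - 1)" "vunit (x + 1) h" "grid_point (x + 1) h"]
      matching_meet[OF M, of "vunit (x + 1) h" "hunit x (h + 1)" "grid_point (x + 1) (h + 1)"]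
      matching_meet[OF M, of "hunit x (h + 1)" "vunit x h" "grid_point x (h + 1)"]
      matching_meet[OF M, of "vunit x h" "vunit x (h - 1)" "grid_point x h"]
      matching_meet[OF M, of "vunit x (h - 1)" "hunit x (h - 1)" "grid_point x (h - 1)"]
    by auto
  show ?thesis
    by (rule that[of "hunit x (h - 1) \<in> M"]) (use alternating_6[OF sum adj] in simp_all)
qed

lemma octagon_alternating:
  assumes M: "matching E M"
    and B: "B = {hunit x (h - 1), hunit (x + 1) (h - 1), vunit (x + 2) (h - 1), vunit (x + 2) h,
      hunit (x + 1) (h + 1), hunit x (h + 1), vunit x h, vunit x (h - 1)}"
    and p: "card B = 2 * p" "card (B \<inter> M) = p"
  obtains b where "hunit x (h - 1) \<in> M \<longleftrightarrow> b" "hunit (x + 1) (h - 1) \<in> M \<longleftrightarrow> \<not> b"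
    "vunit (x + 2) (h - 1) \<in> M \<longleftrightarrow> b" "vunit (x + 2) h \<in> M \<longleftrightarrow> \<not> b"
    "hunit (x + 1) (h + 1) \<in> M \<longleftrightarrow> b" "hunit x (h + 1) \<in> M \<longleftrightarrow> \<not> b" "vunit x h \<in> M \<longleftrightarrow> b"
    "vunit x (h - 1) \<in> M \<longleftrightarrow> \<not> b"
proof -
  have "card B = 8" unfolding B by simp
  then have "card (B \<inter> M) = 4" using p by simp
  moreover have "card (B \<inter> M) = of_bool (hunit x (h - 1) \<in> M) + of_bool (hunit (x + 1) (h - 1) \<in> M)
    + of_bool (vunit (x + 2) (h - 1) \<in> M) + of_bool (vunit (x + 2) h \<in> M)
    + of_bool (hunit (x + 1) (h + 1) \<in> M) + of_bool (hunit x (h + 1) \<in> M) + of_bool (vunit x h \<in> M)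
    + of_bool (vunit x (h - 1) \<in> M)"
    unfolding B by (subst card_Int_eq_sum) simp_all
  ultimately have sum: "of_bool (hunit x (h - 1) \<in> M) + of_bool (hunit (x + 1) (h - 1) \<in> M)
    + of_bool (vunit (x + 2) (h - 1) \<in> M) + of_bool (vunit (x + 2) h \<in> M)
    + of_bool (hunit (x + 1) (h + 1) \<in> M) + of_bool (hunit x (h + 1) \<in> M) + of_bool (vunit x h \<in> M)
    + of_bool (vunit x (h - 1) \<in> M) = (4::nat)" by simp
  have adj: "\<not> (hunit x (h - 1) \<in> M \<and> hunit (x + 1) (h - 1) \<in> M)"
    "\<not> (hunit (x + 1) (h - 1) \<in> M \<and> vunit (x + 2) (h - 1) \<in> M)"
    "\<not> (vunit (x + 2) (h - 1) \<in> M \<and> vunit (x + 2) h \<in> M)"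
    "\<not> (vunit (x + 2) h \<in> M \<and> hunit (x + 1) (h + 1) \<in> M)"
    "\<not> (hunit (x + 1) (h + 1) \<in> M \<and> hunit x (h + 1) \<in> M)"
    "\<not> (hunit x (h + 1) \<in> M \<and> vunit x h \<in> M)"
    "\<not> (vunit x h \<in> M \<and> vunit x (h - 1) \<in> M)"
    "\<not> (vunit x (h - 1) \<in> M \<and> hunit x (h - 1) \<in> M)"
    using matching_meet[OF M, of "hunit x (h - 1)" "hunit (x + 1) (h - 1)" "grid_point (x + 1) (h - 1)"]
      matching_meet[OF M, of "hunit (x + 1) (h - 1)" "vunit (x + 2) (h - 1)" "grid_point (x + 2) (h - 1)"]
      matching_meet[OF M, of "vunit (x + 2) (h - 1)" "vunit (x + 2) h" "grid_point (x + 2) h"]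
      matching_meet[OF M, of "vunit (x + 2) h" "hunit (x + 1) (h + 1)" "grid_point (x + 2) (h + 1)"]
      matching_meet[OF M, of "hunit (x + 1) (h + 1)" "hunit x (h + 1)" "grid_point (x + 1) (h + 1)"]
      matching_meet[OF M, of "hunit x (h + 1)" "vunit x h" "grid_point x (h + 1)"]
      matching_meet[OF M, of "vunit x h" "vunit x (h - 1)" "grid_point x h"]
      matching_meet[OF M, of "vunit x (h - 1)" "hunit x (h - 1)" "grid_point x (h - 1)"]
    by auto
  show ?thesis
    by (rule that[of "hunit x (h - 1) \<in> M"]) (use alternating_8[OF sum adj] in simp_all)
qed

context
  fixes d :: "interlacing list"
begin


definition covered :: "(nat \<times> int \<Rightarrow> int) \<Rightarrow> edge_label \<Rightarrow> bool" where
  "covered N e \<longleftrightarrow> (N (src d e) = N (tgt d e) + 1) \<noteq> reversed d e"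

text \<open>The condition covers all labels on lines of the drawing, including the horizontal ones
  of the end partitions, which are no edges: at a vertex of an outer line the increment across the
  missing edge enters the argument as well.\<close>

definition admissible :: "(nat \<times> int \<Rightarrow> int) \<Rightarrow> bool" where
  "admissible N \<longleftrightarrow> (\<forall>e. edge_line e < length d \<longrightarrow>
     N (src d e) = N (tgt d e) \<or> N (src d e) = N (tgt d e) + 1)"

definition dimers :: "(nat \<times> int \<Rightarrow> int) \<Rightarrow> complex set set" where
  "dimers N = seg d ` {e. edge_ok d e \<and> covered N e}"

lemma seg_in_dimers:
  assumes "edge_ok d e"
  shows "seg d e \<in> dimers N \<longleftrightarrow> covered N e"
proof
  assume "seg d e \<in> dimers N"
  then obtain e' where "seg d e = seg d e'" "covered N e'" by (auto simp: dimers_def)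
  then show "covered N e" using seg_eqD[of d e e'] by (simp add: covered_def)
qed (use assms in \<open>auto simp: dimers_def\<close>)

section \<open>The edges at a vertex and the matching property\<close>

lemma star_on_line:
  obtains c where "\<And>e. edge_line e = j \<Longrightarrow> grid_point (xpos d j) y \<in> seg d e \<Longrightarrow>
      e \<in> {Same j c, Cross j c, if ascending d j then Left j c else Right j c}"
  | c where "\<And>e. edge_line e = j \<Longrightarrow> grid_point (xpos d j) y \<in> seg d e \<Longrightarrow>
      e \<in> {Cross j c, Same j (c + 1), if ascending d j then Right j c else Left j c}"
proof (cases "ascending d j")
  case True
  have "\<exists>c. y = 2 * c + offset d j + 1 \<or> y = 2 * c + offset d j + 2" by presburger
  then obtain c where c: "y = 2 * c + offset d j + 1 \<or> y = 2 * c + offset d j + 2" ..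
  then show ?thesis
  proof
    assume y: "y = 2 * c + offset d j + 1"
    have "e \<in> {Same j c, Cross j c, if ascending d j then Left j c else Right j c}"
      if "edge_line e = j" "grid_point (xpos d j) y \<in> seg d e" for e
      using that True y by (cases e; auto simp: height_def; presburger)
    then show ?thesis by (rule that(1))
  next
    assume y: "y = 2 * c + offset d j + 2"
    have "e \<in> {Cross j c, Same j (c + 1), if ascending d j then Right j c else Left j c}"
      if "edge_line e = j" "grid_point (xpos d j) y \<in> seg d e" for e
      using that True y by (cases e; auto simp: height_def; presburger)
    then show ?thesis by (rule that(2))
  qed
next
  case False
  have "\<exists>c. y = 2 * c + offset d j \<or> y = 2 * c + offset d j + 1" by presburger
  then obtain c where c: "y = 2 * c + offset d j \<or> y = 2 * c + offset d j + 1" ..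
  then show ?thesis
  proof
    assume y: "y = 2 * c + offset d j"
    have "e \<in> {Same j c, Cross j c, if ascending d j then Left j c else Right j c}"
      if "edge_line e = j" "grid_point (xpos d j) y \<in> seg d e" for e
      using that False y by (cases e; auto simp: height_def; presburger)
    then show ?thesis by (rule that(1))
  next
    assume y: "y = 2 * c + offset d j + 1"
    have "e \<in> {Cross j c, Same j (c + 1), if ascending d j then Right j c else Left j c}"
      if "edge_line e = j" "grid_point (xpos d j) y \<in> seg d e" for e
      using that False y by (cases e; auto simp: height_def; presburger)
    then show ?thesis by (rule that(2))
  qed
qed

lemma admissibleD:
  assumes "admissible N" "j < length d"
  shows "N (src d (Left j c)) = N (tgt d (Left j c)) \<or> N (src d (Left j c)) = N (tgt d (Left j c)) + 1"
    "N (src d (Right j c)) = N (tgt d (Right j c)) \<or> N (src d (Right j c)) = N (tgt d (Right j c)) + 1"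
    "N (src d (Same j c)) = N (tgt d (Same j c)) \<or> N (src d (Same j c)) = N (tgt d (Same j c)) + 1"
    "N (src d (Cross j c)) = N (tgt d (Cross j c)) \<or> N (src d (Cross j c)) = N (tgt d (Cross j c)) + 1"
  using assms(1)[unfolded admissible_def, rule_format, of "Left j c"]
    assms(1)[unfolded admissible_def, rule_format, of "Right j c"]
    assms(1)[unfolded admissible_def, rule_format, of "Same j c"]
    assms(1)[unfolded admissible_def, rule_format, of "Cross j c"] assms(2)
  by (simp_all only: edge_line.simps)

text \<open>For \<open>Prec\<close>, the step from (j, c + 1) to (Suc j, c) can pass through (j, c),
  which splits the increment of \<open>Cross\<close> into those of \<open>Left\<close> and
  \<open>Same\<close>. As \<open>Cross\<close> is reversed there, no two of the three are covered.
  The other symbols are analogous; for primed ones it is the horizontal increment that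
  splits.\<close>

lemma covered_star:
  assumes N: "admissible N" and j: "j < length d"
    and e: "e \<in> {Same j c, Cross j c, if ascending d j then Left j c else Right j c}"
      "e' \<in> {Same j c, Cross j c, if ascending d j then Left j c else Right j c}"
    and "covered N e" "covered N e'"
  shows "e = e'"
proof -
  let ?h = "if ascending d j then Left j c else Right j c"
  have "\<not> (covered N (Same j c) \<and> covered N (Cross j c))" "\<not> (covered N (Same j c) \<and> covered N ?h)"
    "\<not> (covered N (Cross j c) \<and> covered N ?h)"
    using admissibleD[OF N j, of c]
    by (cases "d ! j"; simp only: covered_def ascending_def src.simps tgt.simps reversed.simps
        growing.simps primed.simps if_True if_False simp_thms; linarith)+
  with e assms(5,6) show ?thesis by blast
qed

text \<open>The star of the opposite orientation; for \<open>Prec\<close> the intermediate face is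
  now (Suc j, c + 1).\<close>

lemma covered_star':
  assumes N: "admissible N" and j: "j < length d"
    and e: "e \<in> {Cross j c, Same j (c + 1), if ascending d j then Right j c else Left j c}"
      "e' \<in> {Cross j c, Same j (c + 1), if ascending d j then Right j c else Left j c}"
    and "covered N e" "covered N e'"
  shows "e = e'"
proof -
  let ?h = "if ascending d j then Right j c else Left j c"
  have "\<not> (covered N (Cross j c) \<and> covered N (Same j (c + 1)))" "\<not> (covered N (Cross j c) \<and> covered N ?h)"
    "\<not> (covered N (Same j (c + 1)) \<and> covered N ?h)"
    using admissibleD(1,2,4)[OF N j, of c] admissibleD(3)[OF N j, of "c + 1"]
    by (cases "d ! j"; simp only: covered_def ascending_def src.simps tgt.simps reversed.simps
        growing.simps primed.simps if_True if_False simp_thms; linarith)+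
  with e assms(5,6) show ?thesis by blast
qed

text \<open>Distinct edges meet only in lattice points. On a line the two stars apply. Off the lines
  the point is the middle of a subdivided horizontal edge, whose halves compare the same contents
  but differ in \<open>reversed\<close>, so only one of them is covered.\<close>

lemma matching_dimers:
  assumes N: "admissible N"
  shows "matching (graph_edges d) (dimers N)"
proof -
  have meet: "seg d e = seg d e'"
    if e: "edge_ok d e" "covered N e" "z \<in> seg d e" and e': "edge_ok d e'" "covered N e'" "z \<in> seg d e'"
    for e e' z
  proof (rule ccontr)
    assume neq: "seg d e \<noteq> seg d e'"
    have E: "seg d e \<in> graph_edges d" "seg d e' \<in> graph_edges d"
      using e e' by (auto simp: graph_edges_def)
    then obtain x y where z: "z = grid_point x y"
      using grid_edges_Int[of "seg d e" "seg d e'" z] graph_edges_grid[of d] neq e(3) e'(3) by blast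
    show False
    proof (cases "\<exists>j<length d. x = xpos d j")
      case True
      then obtain j where j: "j < length d" "x = xpos d j" by blast
      then have Re: "Re z = of_int (xpos d j)" by (simp add: z grid_point_def)
      obtain f where f: "edge_ok d f" "seg d f = seg d e" "edge_line f = j"
        using edge_on_line[OF e(1,3) Re j(1)] by blast
      obtain f' where f': "edge_ok d f'" "seg d f' = seg d e'" "edge_line f' = j"
        using edge_on_line[OF e'(1,3) Re j(1)] by blast
      have cov: "covered N f" "covered N f'"
        using seg_in_dimers[of f N] seg_in_dimers[of f' N] seg_in_dimers[of e N] seg_in_dimers[of e' N]
          e e' f f' by simp_all
      have mem: "grid_point (xpos d j) y \<in> seg d f" "grid_point (xpos d j) y \<in> seg d f'"
        using e(3) e'(3) z j(2) f(2) f'(2) by simp_all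
      from star_on_line[of j y] have "f = f'"
      proof cases
        case (1 c)
        from covered_star[OF N j(1) 1[OF f(3) mem(1)] 1[OF f'(3) mem(2)] cov] show ?thesis .
      next
        case (2 c)
        from covered_star'[OF N j(1) 2[OF f(3) mem(1)] 2[OF f'(3) mem(2)] cov] show ?thesis .
      qed
      with f f' neq show False by simp
    next
      case False
      then have no: "j < length d \<Longrightarrow> Re z \<noteq> of_int (xpos d j)" for j
        by (auto simp: z grid_point_def)
      have "z \<in> \<Union>(graph_edges d)" using E e(3) by blast
      note bounds = edges_Re_bounds[OF this]
      have "length d - 1 < length d" using edge_ok_line[OF e(1)] by linarith
      with no bounds have "Re z < of_int (xpos d (length d - 1))" by fastforce
      with exists_column[OF bounds(1)] obtain j where
        j: "j < length d - 1" "of_int (xpos d j) \<le> Re z" "Re z < of_int (xpos d (Suc j))" by blast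
      then have "of_int (xpos d j) < Re z" using no[of j] by linarith
      note col = this j(3)
      obtain c where c: "e = Right j c \<or> e = Left (Suc j) c" "Im z = of_int (height d (Suc j) c + 1)"
        using edge_between_lines[OF e(1,3) col] by blast
      obtain c' where c': "e' = Right j c' \<or> e' = Left (Suc j) c'" "Im z = of_int (height d (Suc j) c' + 1)"
        using edge_between_lines[OF e'(1,3) col] by blast
      have "c = c'" using c(2) c'(2) by (simp add: height_def)
      with c(1) c'(1) e(2) e'(2) neq show False
        by (auto simp: covered_def split: if_splits)
    qed
  qed
  have "dimers N \<subseteq> graph_edges d" by (auto simp: dimers_def graph_edges_def)
  moreover have "pairwise disjnt (dimers N)"
    unfolding pairwise_def disjnt_def dimers_def using meet by blast
  ultimately show ?thesis by (simp add: matching_def)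
qed

section \<open>Changing the height at one face\<close>

lemma src_neq_tgt: "src d e \<noteq> tgt d e"
  by (cases e) auto

definition incident :: "nat \<times> int \<Rightarrow> edge_label \<Rightarrow> bool" where
  "incident F e \<longleftrightarrow> src d e = F \<or> tgt d e = F"

text \<open>For e incident with F, this tells whether e has to be covered before the height at F can
  go up: a source needs increment 0, a target needs increment 1, and \<open>reversed\<close>
  exchanges covered and uncovered.\<close>

definition raisable :: "nat \<times> int \<Rightarrow> edge_label \<Rightarrow> bool" where
  "raisable F e \<longleftrightarrow> reversed d e \<noteq> (tgt d e = F)"

text \<open>Around a bounded face no edge is missing, so testing actual edges controls every
  increment that a change at this face affects.\<close>

lemma incident_ok:
  assumes "incident (Suc j, c) e" "edge_line e < length d" "Suc j < length d"
  shows "edge_ok d e"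
  using assms by (cases e) (auto simp: incident_def split: if_splits)

text \<open>Raising one value changes each incident increment by 1. As it lies in {0, 1} before and
  after, its old value is forced and the edge is toggled.\<close>

lemma covered_raise:
  assumes N: "admissible N" and N': "admissible (N(F := N F + 1))" and e: "edge_ok d e"
  shows "covered (N(F := N F + 1)) e \<longleftrightarrow> covered N e \<noteq> incident F e"
    "incident F e \<Longrightarrow> covered N e \<longleftrightarrow> raisable F e"
proof -
  have "N (src d e) = N (tgt d e) \<or> N (src d e) = N (tgt d e) + 1"
    and "(N(F := N F + 1)) (src d e) = (N(F := N F + 1)) (tgt d e) \<or>
      (N(F := N F + 1)) (src d e) = (N(F := N F + 1)) (tgt d e) + 1"
    using N N' edge_ok_line[OF e] unfolding admissible_def by blast+
  then show "covered (N(F := N F + 1)) e \<longleftrightarrow> covered N e \<noteq> incident F e"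
    "incident F e \<Longrightarrow> covered N e \<longleftrightarrow> raisable F e"
    using src_neq_tgt[of e]
    by (auto simp: covered_def incident_def raisable_def split: if_splits)
qed

lemma admissible_raise:
  assumes N: "admissible N" and F: "F = (Suc j, c)" "Suc j < length d"
    and "\<And>e. edge_ok d e \<Longrightarrow> incident F e \<Longrightarrow> covered N e \<longleftrightarrow> raisable F e"
  shows "admissible (N(F := N F + 1))"
  unfolding admissible_def
proof (intro allI impI)
  fix e assume e: "edge_line e < length d"
  have *: "N (src d e) = N (tgt d e) \<or> N (src d e) = N (tgt d e) + 1"
    using N e unfolding admissible_def by blast
  show "(N(F := N F + 1)) (src d e) = (N(F := N F + 1)) (tgt d e) \<or>
      (N(F := N F + 1)) (src d e) = (N(F := N F + 1)) (tgt d e) + 1"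
  proof (cases "incident F e")
    case True
    then have "covered N e \<longleftrightarrow> raisable F e" using incident_ok e F assms(4) by blast
    with True * src_neq_tgt[of e] show ?thesis
      by (auto simp: covered_def incident_def raisable_def)
  next
    case False
    with * show ?thesis by (auto simp: incident_def)
  qed
qed

lemma admissible_lower:
  assumes N: "admissible N" and F: "F = (Suc j, c)" "Suc j < length d"
    and "\<And>e. edge_ok d e \<Longrightarrow> incident F e \<Longrightarrow> covered N e \<longleftrightarrow> \<not> raisable F e"
  shows "admissible (N(F := N F - 1))"
  unfolding admissible_def
proof (intro allI impI)
  fix e assume e: "edge_line e < length d"
  have *: "N (src d e) = N (tgt d e) \<or> N (src d e) = N (tgt d e) + 1"
    using N e unfolding admissible_def by blast
  show "(N(F := N F - 1)) (src d e) = (N(F := N F - 1)) (tgt d e) \<or>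
      (N(F := N F - 1)) (src d e) = (N(F := N F - 1)) (tgt d e) + 1"
  proof (cases "incident F e")
    case True
    then have "covered N e \<longleftrightarrow> \<not> raisable F e" using incident_ok e F assms(4) by blast
    with True * src_neq_tgt[of e] show ?thesis
      by (auto simp: covered_def incident_def raisable_def)
  next
    case False
    with * show ?thesis by (auto simp: incident_def)
  qed
qed

end

section \<open>Flips\<close>

context
  fixes d :: "interlacing list"
begin

section \<open>The sides of a bounded face in cyclic order\<close>

lemma seg_sides:
  "seg d (Right j c) = hunit (xpos d j) (height d (Suc j) c + 1)"
  "seg d (Left (Suc j) c) = hunit (xpos d (Suc j) - 1) (height d (Suc j) c + 1)"
  "height d (Suc j) (c - 1) + 1 = height d (Suc j) c - 1"
  "seg d (lower_side d j c) = vunit (xpos d j) (height d (Suc j) c - 1)"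
  "seg d (upper_side d j c) = vunit (xpos d j) (height d (Suc j) c)"
  "seg d (lower_side' d (Suc j) c) = vunit (xpos d (Suc j)) (height d (Suc j) c - 1)"
  "seg d (upper_side' d (Suc j) c) = vunit (xpos d (Suc j)) (height d (Suc j) c)"
  by (auto simp: height_def lower_side_def upper_side_def lower_side'_def upper_side'_def)

text \<open>Read around the cell, these values alternate. Between lines of the same type the halves
  of a horizontal side agree and form one of six sides; between lines of different type they
  disagree, which fits a border of eight.\<close>

lemma raisable_sides:
  "raisable d (Suc j, c) (Right j c) \<longleftrightarrow> primed (d ! j)"
  "raisable d (Suc j, c) (Right j (c - 1)) \<longleftrightarrow> \<not> primed (d ! j)"
  "raisable d (Suc j, c) (Left (Suc j) c) \<longleftrightarrow> primed (d ! Suc j)"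
  "raisable d (Suc j, c) (Left (Suc j) (c - 1)) \<longleftrightarrow> \<not> primed (d ! Suc j)"
  "raisable d (Suc j, c) (lower_side d j c) \<longleftrightarrow> primed (d ! j)"
  "raisable d (Suc j, c) (upper_side d j c) \<longleftrightarrow> \<not> primed (d ! j)"
  "raisable d (Suc j, c) (lower_side' d (Suc j) c) \<longleftrightarrow> primed (d ! Suc j)"
  "raisable d (Suc j, c) (upper_side' d (Suc j) c) \<longleftrightarrow> \<not> primed (d ! Suc j)"
  by (auto simp: raisable_def lower_side_def upper_side_def lower_side'_def upper_side'_def
      ascending_def)

lemma cell_labels_ok:
  assumes "Suc j < length d" "e \<in> cell_labels d j c"
  shows "edge_ok d e"
  using assms
  by (auto simp: cell_labels_def lower_side_def upper_side_def lower_side'_def upper_side'_def)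

lemma mem_cell_labels:
  assumes "Suc j < length d" "edge_ok d e"
  shows "e \<in> cell_labels d j c \<longleftrightarrow> incident d (Suc j, c) e"
  using cell_labels_iff[OF assms(1), of e c] assms(2) by (simp add: incident_def)

lemma dimers_toggle:
  assumes j: "Suc j < length d"
    and "\<And>e. edge_ok d e \<Longrightarrow> covered d N' e \<longleftrightarrow> covered d N e \<noteq> incident d (Suc j, c) e"
  shows "dimers d N' = (dimers d N - border (graph_edges d) (cell d j c)) \<union>
    (border (graph_edges d) (cell d j c) - dimers d N)" (is "_ = ?R")
proof -
  have B: "seg d e \<in> border (graph_edges d) (cell d j c) \<longleftrightarrow> incident d (Suc j, c) e"
    if e: "edge_ok d e" for e
  proof
    assume "seg d e \<in> border (graph_edges d) (cell d j c)"
    then obtain e' where e': "e' \<in> cell_labels d j c" "seg d e = seg d e'"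
      unfolding border_cell[OF j] by blast
    then have "incident d (Suc j, c) e'" using mem_cell_labels[OF j] cell_labels_ok[OF j] by blast
    then show "incident d (Suc j, c) e" using seg_eqD[OF e'(2)] by (simp add: incident_def)
  next
    assume "incident d (Suc j, c) e"
    then show "seg d e \<in> border (graph_edges d) (cell d j c)"
      unfolding border_cell[OF j] using mem_cell_labels[OF j e] by blast
  qed
  have "seg d e \<in> dimers d N' \<longleftrightarrow> seg d e \<in> ?R" if "edge_ok d e" for e
    using assms(2)[OF that] B[OF that] seg_in_dimers[OF that] by auto
  moreover have "dimers d N' \<subseteq> seg d ` Collect (edge_ok d)" "?R \<subseteq> seg d ` Collect (edge_ok d)"
    by (auto simp: dimers_def border_def graph_edges_def)
  ultimately show ?thesis by blast
qed

lemma border_cell_hexagon: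
  assumes "Suc j < length d" "primed (d ! j) = primed (d ! Suc j)"
  shows "border (graph_edges d) (cell d j c) = {hunit (xpos d j) (height d (Suc j) c - 1),
    vunit (xpos d j + 1) (height d (Suc j) c - 1), vunit (xpos d j + 1) (height d (Suc j) c),
    hunit (xpos d j) (height d (Suc j) c + 1), vunit (xpos d j) (height d (Suc j) c),
    vunit (xpos d j) (height d (Suc j) c - 1)}"
proof -
  have x: "xpos d (Suc j) = xpos d j + 1" using assms(2) by simp
  show ?thesis
    unfolding border_cell[OF assms(1)] cell_labels_def image_insert image_empty seg_sides x add_diff_cancel_right'
    by blast
qed

lemma border_cell_octagon:
  assumes "Suc j < length d" "primed (d ! j) \<noteq> primed (d ! Suc j)"
  shows "border (graph_edges d) (cell d j c) = {hunit (xpos d j) (height d (Suc j) c - 1),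
    hunit (xpos d j + 1) (height d (Suc j) c - 1),
    vunit (xpos d j + 2) (height d (Suc j) c - 1), vunit (xpos d j + 2) (height d (Suc j) c),
    hunit (xpos d j + 1) (height d (Suc j) c + 1),
    hunit (xpos d j) (height d (Suc j) c + 1), vunit (xpos d j) (height d (Suc j) c),
    vunit (xpos d j) (height d (Suc j) c - 1)}"
proof -
  have x: "xpos d (Suc j) = xpos d j + 2" "xpos d j + 2 - 1 = xpos d j + 1" using assms(2) by simp_all
  show ?thesis
    unfolding border_cell[OF assms(1)] cell_labels_def image_insert image_empty seg_sides x
    by blast
qed

lemma cell_labels_covered:
  "(\<forall>e\<in>cell_labels d j c. covered d N e \<longleftrightarrow> P e) \<longleftrightarrow>
    (\<forall>e\<in>cell_labels d j c. seg d e \<in> dimers d N \<longleftrightarrow> P e)" if "Suc j < length d"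
  using seg_in_dimers cell_labels_ok[OF that] by blast

text \<open>The matching alternates on the border of a face that can be flipped, and so does
  \<open>raisable\<close>; two alternating patterns agree everywhere or nowhere.\<close>

lemma alternating_raisable_or_lowerable:
  assumes N: "admissible d N" and j: "Suc j < length d"
    and p: "card (border (graph_edges d) (cell d j c)) = 2 * p"
      "card (border (graph_edges d) (cell d j c) \<inter> dimers d N) = p"
  shows "(\<forall>e\<in>cell_labels d j c. covered d N e \<longleftrightarrow> raisable d (Suc j, c) e) \<or>
    (\<forall>e\<in>cell_labels d j c. covered d N e \<longleftrightarrow> \<not> raisable d (Suc j, c) e)"
proof (cases "primed (d ! j) = primed (d ! Suc j)")
  case True
  from hexagon_alternating[OF matching_dimers[OF N] border_cell_hexagon[OF j True] p]
  obtain b where b: "hunit (xpos d j) (height d (Suc j) c - 1) \<in> dimers d N \<longleftrightarrow> b"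
    "vunit (xpos d j + 1) (height d (Suc j) c - 1) \<in> dimers d N \<longleftrightarrow> \<not> b"
    "vunit (xpos d j + 1) (height d (Suc j) c) \<in> dimers d N \<longleftrightarrow> b"
    "hunit (xpos d j) (height d (Suc j) c + 1) \<in> dimers d N \<longleftrightarrow> \<not> b"
    "vunit (xpos d j) (height d (Suc j) c) \<in> dimers d N \<longleftrightarrow> b"
    "vunit (xpos d j) (height d (Suc j) c - 1) \<in> dimers d N \<longleftrightarrow> \<not> b" .
  have x: "xpos d (Suc j) = xpos d j + 1" using True by simp
  show ?thesis
    unfolding cell_labels_covered[OF j] unfolding cell_labels_def ball_simps seg_sides raisable_sides x add_diff_cancel_right'
    using True by (simp only: b) blast
next
  case False
  from octagon_alternating[OF matching_dimers[OF N] border_cell_octagon[OF j False] p]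
  obtain b where b: "hunit (xpos d j) (height d (Suc j) c - 1) \<in> dimers d N \<longleftrightarrow> b"
    "hunit (xpos d j + 1) (height d (Suc j) c - 1) \<in> dimers d N \<longleftrightarrow> \<not> b"
    "vunit (xpos d j + 2) (height d (Suc j) c - 1) \<in> dimers d N \<longleftrightarrow> b"
    "vunit (xpos d j + 2) (height d (Suc j) c) \<in> dimers d N \<longleftrightarrow> \<not> b"
    "hunit (xpos d j + 1) (height d (Suc j) c + 1) \<in> dimers d N \<longleftrightarrow> b"
    "hunit (xpos d j) (height d (Suc j) c + 1) \<in> dimers d N \<longleftrightarrow> \<not> b"
    "vunit (xpos d j) (height d (Suc j) c) \<in> dimers d N \<longleftrightarrow> b"
    "vunit (xpos d j) (height d (Suc j) c - 1) \<in> dimers d N \<longleftrightarrow> \<not> b" .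
  have x: "xpos d (Suc j) = xpos d j + 2" "xpos d j + 2 - 1 = xpos d j + 1" using False by simp_all
  show ?thesis
    unfolding cell_labels_covered[OF j] unfolding cell_labels_def ball_simps seg_sides raisable_sides x
    using False by (simp only: b) blast
qed

lemma card_border_raisable:
  assumes j: "Suc j < length d"
    and cov: "\<forall>e\<in>cell_labels d j c. covered d N e \<longleftrightarrow> raisable d (Suc j, c) e"
  obtains p where "p \<ge> 1" "card (border (graph_edges d) (cell d j c)) = 2 * p"
    "card (border (graph_edges d) (cell d j c) \<inter> dimers d N) = p"
proof (cases "primed (d ! j) = primed (d ! Suc j)")
  case True
  have x: "xpos d (Suc j) = xpos d j + 1" using True by simp
  have "card (border (graph_edges d) (cell d j c)) = 2 * 3"
    unfolding border_cell_hexagon[OF j True] by simp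
  moreover have "card (border (graph_edges d) (cell d j c) \<inter> dimers d N) = 3"
    using cov[unfolded cell_labels_covered[OF j], unfolded cell_labels_def ball_simps seg_sides raisable_sides x
        add_diff_cancel_right'] True
    unfolding border_cell_hexagon[OF j True]
    by (subst card_Int_eq_sum, simp) (cases "primed (d ! Suc j)"; simp del: sum_of_bool_eq)
  ultimately show ?thesis by (intro that[of 3]) simp_all
next
  case False
  have x: "xpos d (Suc j) = xpos d j + 2" "xpos d j + 2 - 1 = xpos d j + 1" using False by simp_all
  have "card (border (graph_edges d) (cell d j c)) = 2 * 4"
    unfolding border_cell_octagon[OF j False] by simp
  moreover have "card (border (graph_edges d) (cell d j c) \<inter> dimers d N) = 4"
    using cov[unfolded cell_labels_covered[OF j], unfolded cell_labels_def ball_simps seg_sides raisable_sides x] False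
    unfolding border_cell_octagon[OF j False]
    by (subst card_Int_eq_sum, simp) (cases "primed (d ! Suc j)"; simp del: sum_of_bool_eq)
  ultimately show ?thesis by (intro that[of 4]) simp_all
qed

section \<open>Flips as unit changes of the height\<close>

definition graph_flip :: "complex set set \<Rightarrow> complex set set \<Rightarrow> bool" where
  "graph_flip = flip (grid_vertices (graph_edges d)) (graph_edges d)"

lemma cell_bounded_face:
  assumes "Suc j < length d"
  shows "cell d j c \<in> faces (grid_vertices (graph_edges d)) (graph_edges d)" "bounded (cell d j c)"
proof -
  have "d \<noteq> []" using assms by auto
  then have "cell d j c \<in> {f \<in> faces (grid_vertices (graph_edges d)) (graph_edges d). bounded f}"
    unfolding bounded_faces_graph[OF \<open>d \<noteq> []\<close>] using assms by blast
  then show "cell d j c \<in> faces (grid_vertices (graph_edges d)) (graph_edges d)" "bounded (cell d j c)"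
    by blast+
qed

text \<open>Raising toggles exactly the border, half of which was selected. The complementary half
  is selected afterwards, so the same face also serves for the flip back.\<close>

lemma graph_flip_raise:
  assumes j: "Suc j < length d" and F: "F = (Suc j, c)"
    and N: "admissible d N" and N': "admissible d (N(F := N F + 1))"
  shows "graph_flip (dimers d N) (dimers d (N(F := N F + 1)))"
    "graph_flip (dimers d (N(F := N F + 1))) (dimers d N)"
proof -
  let ?B = "border (graph_edges d) (cell d j c)" and ?M = "dimers d N"
  let ?M' = "dimers d (N(F := N F + 1))"
  have cov: "\<forall>e\<in>cell_labels d j c. covered d N e \<longleftrightarrow> raisable d (Suc j, c) e"
    using covered_raise(2)[OF N N'] mem_cell_labels[OF j] cell_labels_ok[OF j] F by blast
  then obtain p where p: "p \<ge> 1" "card ?B = 2 * p" "card (?B \<inter> ?M) = p"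
    by (rule card_border_raisable[OF j])
  have M': "?M' = (?M - ?B) \<union> (?B - ?M)"
    using covered_raise(1)[OF N N'] F by (intro dimers_toggle[OF j]) auto
  have M: "?M = (?M' - ?B) \<union> (?B - ?M')" using M' by blast
  have "finite ?B" using p(1,2) by (intro card_ge_0_finite) simp
  have "?B \<inter> ?M' = ?B - ?B \<inter> ?M" using M' by blast
  then have p': "card (?B \<inter> ?M') = p"
    using p(2,3) \<open>finite ?B\<close> by (simp add: card_Diff_subset)
  note matchings = matching_dimers[OF N] matching_dimers[OF N']
  show "graph_flip ?M ?M'" unfolding graph_flip_def flip_def
    using matchings cell_bounded_face[OF j] p M' by blast
  show "graph_flip ?M' ?M" unfolding graph_flip_def flip_def
    using matchings cell_bounded_face[OF j] p(1,2) p' M by blast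
qed

lemma graph_flipE:
  assumes "graph_flip (dimers d N) M'" and N: "admissible d N" and "d \<noteq> []"
  obtains j c where "Suc j < length d" "admissible d (N((Suc j, c) := N (Suc j, c) + 1))"
      "M' = dimers d (N((Suc j, c) := N (Suc j, c) + 1))"
  | j c where "Suc j < length d" "admissible d (N((Suc j, c) := N (Suc j, c) - 1))"
      "M' = dimers d (N((Suc j, c) := N (Suc j, c) - 1))"
proof -
  from assms(1) obtain f p where f: "f \<in> faces (grid_vertices (graph_edges d)) (graph_edges d)" "bounded f"
    and p: "card (border (graph_edges d) f) = 2 * p" "card (border (graph_edges d) f \<inter> dimers d N) = p"
    and M': "M' = (dimers d N - border (graph_edges d) f) \<union> (border (graph_edges d) f - dimers d N)"
    unfolding graph_flip_def flip_def by blast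
  from f bounded_faces_graph[OF assms(3)] obtain j c where j: "Suc j < length d" and fc: "f = cell d j c"
    by blast
  have inc: "edge_ok d e \<Longrightarrow> incident d (Suc j, c) e \<Longrightarrow> e \<in> cell_labels d j c" for e
    using mem_cell_labels[OF j] by blast
  from alternating_raisable_or_lowerable[OF N j p[unfolded fc]] show ?thesis
  proof
    assume *: "\<forall>e\<in>cell_labels d j c. covered d N e \<longleftrightarrow> raisable d (Suc j, c) e"
    let ?N' = "N((Suc j, c) := N (Suc j, c) + 1)"
    have N': "admissible d ?N'"
      using * inc by (intro admissible_raise[OF N refl j]) blast
    have "dimers d ?N' = M'" unfolding M' fc
      using covered_raise(1)[OF N N'] by (intro dimers_toggle[OF j]) auto
    with N' j show ?thesis by (intro that(1)[of j c]) simp_all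
  next
    assume *: "\<forall>e\<in>cell_labels d j c. covered d N e \<longleftrightarrow> \<not> raisable d (Suc j, c) e"
    let ?N' = "N((Suc j, c) := N (Suc j, c) - 1)"
    have N': "admissible d ?N'"
      using * inc by (intro admissible_lower[OF N refl j]) blast
    \<comment> \<open>Raising the lowered height gives N back, so the toggling lemma for raising
      applies with the two heights exchanged.\<close>
    have "?N'((Suc j, c) := ?N' (Suc j, c) + 1) = N" by simp
    then have "\<And>e. edge_ok d e \<Longrightarrow> covered d N e \<longleftrightarrow> covered d ?N' e \<noteq> incident d (Suc j, c) e"
      using covered_raise(1)[OF N', of "(Suc j, c)"] N by simp
    then have "dimers d ?N' = M'" unfolding M' fc
      by (intro dimers_toggle[OF j]) auto
    with N' j show ?thesis by (intro that(2)[of j c]) simp_all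
  qed
qed

end

section \<open>Interlacing sequences as height functions\<close>

text \<open>The strip supplies two of the four bounds on the increments. The other two follow since
  the counts of \<mu> drop by 0 or 1 from c to c + 1; for vertical strips the drops of \<nu> play
  this part.\<close>

lemma hstrip_iff_beads:
  assumes \<mu>: "is_partition \<mu>" and \<nu>: "is_partition \<nu>"
  shows "hstrip \<mu> \<nu> \<longleftrightarrow>
    (\<forall>c. beads_above \<nu> c = beads_above \<mu> c \<or> beads_above \<nu> c = beads_above \<mu> c + 1) \<and>
    (\<forall>c. beads_above \<nu> c = beads_above \<mu> (c + 1) \<or> beads_above \<nu> c = beads_above \<mu> (c + 1) + 1)"
    (is "_ \<longleftrightarrow> ?R")
proof -
  have "hstrip \<mu> \<nu> \<longleftrightarrow> (\<forall>c. beads_above \<mu> c \<le> beads_above \<nu> c) \<and>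
      (\<forall>c. beads_above \<nu> c \<le> beads_above \<mu> (c + 1) + 1)"
    unfolding beads_above_le_iff[OF \<mu> \<nu>] beads_above_le_Suc_iff[OF \<mu> \<nu>] hstrip_iff[OF \<mu> \<nu>] by blast
  also have "\<dots> \<longleftrightarrow> (\<forall>c. beads_above \<mu> c \<le> beads_above \<nu> c \<and> beads_above \<nu> c \<le> beads_above \<mu> (c + 1) + 1)"
    by blast
  also have "\<dots> \<longleftrightarrow> (\<forall>c. (beads_above \<nu> c = beads_above \<mu> c \<or> beads_above \<nu> c = beads_above \<mu> c + 1) \<and>
      (beads_above \<nu> c = beads_above \<mu> (c + 1) \<or> beads_above \<nu> c = beads_above \<mu> (c + 1) + 1))"
  proof (rule all_cong1)
    fix c
    show "beads_above \<mu> c \<le> beads_above \<nu> c \<and> beads_above \<nu> c \<le> beads_above \<mu> (c + 1) + 1 \<longleftrightarrow>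
      (beads_above \<nu> c = beads_above \<mu> c \<or> beads_above \<nu> c = beads_above \<mu> c + 1) \<and>
      (beads_above \<nu> c = beads_above \<mu> (c + 1) \<or> beads_above \<nu> c = beads_above \<mu> (c + 1) + 1)"
      using beads_above_step(1)[OF \<mu>, of c] by linarith
  qed
  also have "\<dots> \<longleftrightarrow> ?R" by blast
  finally show ?thesis .
qed

lemma vstrip_iff_beads:
  assumes \<mu>: "is_partition \<mu>" and \<nu>: "is_partition \<nu>"
  shows "vstrip \<mu> \<nu> \<longleftrightarrow>
    (\<forall>c. beads_above \<nu> c = beads_above \<mu> c \<or> beads_above \<nu> c = beads_above \<mu> c + 1) \<and>
    (\<forall>c. beads_above \<mu> c = beads_above \<nu> (c + 1) \<or> beads_above \<mu> c = beads_above \<nu> (c + 1) + 1)"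
    (is "_ \<longleftrightarrow> ?R")
proof -
  have "vstrip \<mu> \<nu> \<longleftrightarrow> (\<forall>c. beads_above \<mu> c \<le> beads_above \<nu> c) \<and>
      (\<forall>c. beads_above \<nu> (c + 1) \<le> beads_above \<mu> c)"
    unfolding beads_above_le_iff[OF \<mu> \<nu>] beads_above_le_shift_iff[OF \<mu> \<nu>] vstrip_iff by blast
  also have "\<dots> \<longleftrightarrow> (\<forall>c. beads_above \<mu> c \<le> beads_above \<nu> c \<and> beads_above \<nu> (c + 1) \<le> beads_above \<mu> c)"
    by blast
  also have "\<dots> \<longleftrightarrow> (\<forall>c. (beads_above \<nu> c = beads_above \<mu> c \<or> beads_above \<nu> c = beads_above \<mu> c + 1) \<and>
      (beads_above \<mu> c = beads_above \<nu> (c + 1) \<or> beads_above \<mu> c = beads_above \<nu> (c + 1) + 1))"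
  proof (rule all_cong1)
    fix c
    show "beads_above \<mu> c \<le> beads_above \<nu> c \<and> beads_above \<nu> (c + 1) \<le> beads_above \<mu> c \<longleftrightarrow>
      (beads_above \<nu> c = beads_above \<mu> c \<or> beads_above \<nu> c = beads_above \<mu> c + 1) \<and>
      (beads_above \<mu> c = beads_above \<nu> (c + 1) \<or> beads_above \<mu> c = beads_above \<nu> (c + 1) + 1)"
      using beads_above_step[OF \<nu>, of c] by linarith
  qed
  also have "\<dots> \<longleftrightarrow> ?R" by blast
  finally show ?thesis .
qed

section \<open>Removing a box next to a fixed neighbour\<close>

lemma interlaces_iff_pointwise:
  assumes "is_partition l" "is_partition r"
  shows "interlaces x l r \<longleftrightarrow> (case x of
      Prec \<Rightarrow> \<forall>s. l s \<le> r s \<and> r (Suc s) \<le> l s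
    | Succ \<Rightarrow> \<forall>s. r s \<le> l s \<and> l (Suc s) \<le> r s
    | Prec' \<Rightarrow> \<forall>s. l s \<le> r s \<and> r s \<le> Suc (l s)
    | Succ' \<Rightarrow> \<forall>s. r s \<le> l s \<and> l s \<le> Suc (r s))"
  using assms by (cases x) (simp_all add: hstrip_iff vstrip_iff)

text \<open>Lowering \<mu> in row t can break only the conditions that bound \<open>\<mu> t\<close>
  from below: \<open>l t \<le> \<mu> t\<close> (for a growing symbol),
  \<open>l (Suc t) \<le> \<mu> t\<close> and \<open>l t \<le> Suc (\<mu> t)\<close>. The hypotheses
  on l preserve these.\<close>

lemma interlaces_remove_box_right:
  assumes part: "is_partition l" "is_partition \<mu>" "is_partition (\<mu>(t := v))"
    and inter: "interlaces x l \<mu>" and v: "\<mu> t = Suc v"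
    and l: "l t \<le> Suc v" "l (Suc t) \<le> v" "growing x \<longrightarrow> l t \<le> v"
  shows "interlaces x l (\<mu>(t := v))"
proof -
  define \<nu> where "\<nu> = \<mu>(t := v)"
  have le: "\<nu> s \<le> \<mu> s" and same: "s \<noteq> t \<Longrightarrow> \<nu> s = \<mu> s" and at: "\<nu> t = v" for s
    using v by (auto simp: \<nu>_def)
  have "l s \<le> \<nu> s" if "growing x" "l s \<le> \<mu> s" for s
    using that same[of s] at l by (cases "s = t") auto
  moreover have "l (Suc s) \<le> \<nu> s" if "l (Suc s) \<le> \<mu> s" for s
    using that same[of s] at l by (cases "s = t") auto
  moreover have "l s \<le> Suc (\<nu> s)" if "l s \<le> Suc (\<mu> s)" for s
    using that same[of s] at l by (cases "s = t") auto
  ultimately show ?thesis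
    using inter le[THEN le_trans]
    unfolding interlaces_iff_pointwise[OF part(1,2)] interlaces_iff_pointwise[OF part(1,3)]
    unfolding \<nu>_def[symmetric] by (cases x) simp_all
qed

lemma interlaces_remove_box_left:
  assumes part: "is_partition l" "is_partition \<mu>" "is_partition (\<mu>(t := v))"
    and inter: "interlaces x \<mu> l" and v: "\<mu> t = Suc v"
    and l: "l t \<le> Suc v" "l (Suc t) \<le> v" "\<not> growing x \<longrightarrow> l t \<le> v"
  shows "interlaces x (\<mu>(t := v)) l"
proof -
  define \<nu> where "\<nu> = \<mu>(t := v)"
  have le: "\<nu> s \<le> \<mu> s" and same: "s \<noteq> t \<Longrightarrow> \<nu> s = \<mu> s" and at: "\<nu> t = v" for s
    using v by (auto simp: \<nu>_def)
  have "l s \<le> \<nu> s" if "\<not> growing x" "l s \<le> \<mu> s" for s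
    using that same[of s] at l by (cases "s = t") auto
  moreover have "l (Suc s) \<le> \<nu> s" if "l (Suc s) \<le> \<mu> s" for s
    using that same[of s] at l by (cases "s = t") auto
  moreover have "l s \<le> Suc (\<nu> s)" if "l s \<le> Suc (\<mu> s)" for s
    using that same[of s] at l by (cases "s = t") auto
  ultimately show ?thesis
    using inter le[THEN le_trans]
    unfolding interlaces_iff_pointwise[OF part(2,1)] interlaces_iff_pointwise[OF part(3,1)]
    unfolding \<nu>_def[symmetric] by (cases x) simp_all
qed

definition state :: "(nat \<Rightarrow> nat) list \<Rightarrow> nat \<times> int \<Rightarrow> int" where
  "state ls = (\<lambda>(i, c). beads_above (ls ! i) c)"

lemma state_update:
  assumes "i < length ls" "beads_above \<nu> = (beads_above (ls ! i))(c := v)"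
  shows "state (ls[i := \<nu>]) = (state ls)((i, c) := v)"
  using assms by (auto simp: state_def fun_eq_iff nth_list_update)

definition seq_size :: "(nat \<Rightarrow> nat) list \<Rightarrow> nat" where
  "seq_size ls = (\<Sum>i<length ls. partition_size (ls ! i))"

text \<open>Written with a sum on each side to avoid truncated subtraction.\<close>

lemma seq_size_update:
  assumes "i < length ls"
  shows "seq_size (ls[i := \<nu>]) + partition_size (ls ! i) = seq_size ls + partition_size \<nu>"
proof -
  have "(\<Sum>j\<in>{..<length ls} - {i}. partition_size (ls[i := \<nu>] ! j)) =
      (\<Sum>j\<in>{..<length ls} - {i}. partition_size (ls ! j))"
    by (rule sum.cong) auto
  then show ?thesis
    unfolding seq_size_def using assms
    by (simp add: sum.remove[of "{..<length ls}" i])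
qed

context
  fixes d :: "interlacing list"
begin

text \<open>Horizontal increments belong to a single partition and are automatically 0 or 1; those
  across line j express the interlacing of its two neighbours.\<close>

lemma admissible_state_iff:
  assumes len: "length ls = Suc (length d)" and part: "\<forall>\<mu>\<in>set ls. is_partition \<mu>"
  shows "admissible d (state ls) \<longleftrightarrow> (\<forall>j<length d. interlaces (d ! j) (ls ! j) (ls ! Suc j))"
proof -
  have p: "is_partition (ls ! i)" if "i \<le> length d" for i using that len part by simp
  let ?A = "\<lambda>e. state ls (src d e) = state ls (tgt d e) \<or> state ls (src d e) = state ls (tgt d e) + 1"
  have horizontal: "?A (Left j c)" "?A (Right j c)" if "j < length d" for j c
    using beads_above_step[OF p, of j c] beads_above_step[OF p, of "Suc j" c] that
    by (simp_all add: state_def) linarith+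
  have line: "(\<forall>c. ?A (Same j c)) \<and> (\<forall>c. ?A (Cross j c)) \<longleftrightarrow> interlaces (d ! j) (ls ! j) (ls ! Suc j)"
    if "j < length d" for j
    using hstrip_iff_beads[OF p p, of j "Suc j"] hstrip_iff_beads[OF p p, of "Suc j" j]
      vstrip_iff_beads[OF p p, of j "Suc j"] vstrip_iff_beads[OF p p, of "Suc j" j] that
    by (cases "d ! j") (simp_all add: state_def ascending_def)
  have "admissible d (state ls) \<longleftrightarrow> (\<forall>j<length d. (\<forall>c. ?A (Same j c)) \<and> (\<forall>c. ?A (Cross j c)))"
  proof
    assume "admissible d (state ls)"
    then show "\<forall>j<length d. (\<forall>c. ?A (Same j c)) \<and> (\<forall>c. ?A (Cross j c))"
      using admissibleD(3,4) by blast
  next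
    assume *: "\<forall>j<length d. (\<forall>c. ?A (Same j c)) \<and> (\<forall>c. ?A (Cross j c))"
    show "admissible d (state ls)"
      unfolding admissible_def
    proof (intro allI impI)
      fix e assume "edge_line e < length d"
      with * horizontal show "?A e" by (cases e) (simp_all del: src.simps tgt.simps)
    qed
  qed
  with line show ?thesis by simp
qed

lemma pure_seqs_iff:
  "ls \<in> pure_seqs d \<longleftrightarrow> length ls = Suc (length d) \<and> (\<forall>\<mu>\<in>set ls. is_partition \<mu>) \<and>
    ls ! 0 = empty_partition \<and> ls ! length d = empty_partition \<and> admissible d (state ls)"
proof (cases "length ls = Suc (length d) \<and> (\<forall>\<mu>\<in>set ls. is_partition \<mu>)")
  case True
  then have "ls \<noteq> []" by auto
  with True have "hd ls = ls ! 0" "last ls = ls ! length d"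
    by (simp_all add: hd_conv_nth last_conv_nth)
  with True admissible_state_iff[of ls] show ?thesis
    by (auto simp: pure_seqs_def interlacing_seqs_def)
qed (auto simp: pure_seqs_def interlacing_seqs_def)

lemma pure_update:
  assumes ls: "ls \<in> pure_seqs d" and j: "Suc j < length d" and "is_partition \<nu>"
    and "beads_above \<nu> = (beads_above (ls ! Suc j))(c := v)"
    and "admissible d ((state ls)((Suc j, c) := v))"
  shows "ls[Suc j := \<nu>] \<in> pure_seqs d" "state (ls[Suc j := \<nu>]) = (state ls)((Suc j, c) := v)"
proof -
  show *: "state (ls[Suc j := \<nu>]) = (state ls)((Suc j, c) := v)"
    using assms by (intro state_update) (auto simp: pure_seqs_iff)
  show "ls[Suc j := \<nu>] \<in> pure_seqs d"
    unfolding pure_seqs_iff * using assms set_update_subset_insert[of ls "Suc j" \<nu>]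
    by (auto simp: pure_seqs_iff)
qed

lemma partition_nth:
  assumes "ls \<in> pure_seqs d" "i \<le> length d"
  shows "is_partition (ls ! i)"
  using assms by (simp add: pure_seqs_iff)

text \<open>The horizontal increments next to c are 0 or 1 both before and after the change. This
  pins them down: there is a bead at c and none at c + 1, so raising the height means adding a
  box.\<close>

lemma pure_raise:
  assumes ls: "ls \<in> pure_seqs d" and j: "Suc j < length d"
    and N': "admissible d ((state ls)((Suc j, c) := state ls (Suc j, c) + 1))"
  obtains ls' where "ls' \<in> pure_seqs d" "state ls' = (state ls)((Suc j, c) := state ls (Suc j, c) + 1)"
    "seq_size ls' = seq_size ls + 1"
proof -
  have p: "is_partition (ls ! Suc j)" using ls j by (simp add: partition_nth)
  have N: "admissible d (state ls)" using ls by (simp add: pure_seqs_iff)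
  have "j < length d" using j by simp
  note adm = admissibleD(2)[OF N this] admissibleD(2)[OF N' this]
  have "beads_above (ls ! Suc j) (c + 1) = beads_above (ls ! Suc j) c"
    "beads_above (ls ! Suc j) (c - 1) = beads_above (ls ! Suc j) c + 1"
    using adm(1)[of c] adm(1)[of "c - 1"] adm(2)[of c] adm(2)[of "c - 1"] by (auto simp: state_def)
  then obtain \<nu> where \<nu>: "is_partition \<nu>"
    "beads_above \<nu> = (beads_above (ls ! Suc j))(c := beads_above (ls ! Suc j) c + 1)"
    "partition_size \<nu> = partition_size (ls ! Suc j) + 1"
    by (rule ex_add_box[OF p])
  show ?thesis
  proof (rule that)
    have "beads_above \<nu> = (beads_above (ls ! Suc j))(c := state ls (Suc j, c) + 1)"
      using \<nu>(2) by (simp add: state_def)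
    from pure_update[OF ls j \<nu>(1) this N'] show "ls[Suc j := \<nu>] \<in> pure_seqs d"
      "state (ls[Suc j := \<nu>]) = (state ls)((Suc j, c) := state ls (Suc j, c) + 1)" .
    have "Suc j < length ls" using ls j by (simp add: pure_seqs_iff)
    from seq_size_update[OF this, of \<nu>] \<nu>(3) show "seq_size (ls[Suc j := \<nu>]) = seq_size ls + 1"
      by simp
  qed
qed

lemma pure_lower:
  assumes ls: "ls \<in> pure_seqs d" and j: "Suc j < length d"
    and N': "admissible d ((state ls)((Suc j, c) := state ls (Suc j, c) - 1))"
  obtains ls' where "ls' \<in> pure_seqs d" "state ls' = (state ls)((Suc j, c) := state ls (Suc j, c) - 1)"
    "seq_size ls = seq_size ls' + 1"
proof -
  have p: "is_partition (ls ! Suc j)" using ls j by (simp add: partition_nth)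
  have N: "admissible d (state ls)" using ls by (simp add: pure_seqs_iff)
  have "j < length d" using j by simp
  note adm = admissibleD(2)[OF N this] admissibleD(2)[OF N' this]
  have "beads_above (ls ! Suc j) c = beads_above (ls ! Suc j) (c + 1) + 1"
    "beads_above (ls ! Suc j) (c - 1) = beads_above (ls ! Suc j) c"
    using adm(1)[of c] adm(1)[of "c - 1"] adm(2)[of c] adm(2)[of "c - 1"] by (auto simp: state_def)
  then obtain \<nu> where \<nu>: "is_partition \<nu>"
    "beads_above \<nu> = (beads_above (ls ! Suc j))(c := beads_above (ls ! Suc j) c - 1)"
    "partition_size (ls ! Suc j) = partition_size \<nu> + 1"
    by (rule ex_remove_box[OF p])
  show ?thesis
  proof (rule that)
    have "beads_above \<nu> = (beads_above (ls ! Suc j))(c := state ls (Suc j, c) - 1)"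
      using \<nu>(2) by (simp add: state_def)
    from pure_update[OF ls j \<nu>(1) this N'] show "ls[Suc j := \<nu>] \<in> pure_seqs d"
      "state (ls[Suc j := \<nu>]) = (state ls)((Suc j, c) := state ls (Suc j, c) - 1)" .
    have "Suc j < length ls" using ls j by (simp add: pure_seqs_iff)
    from seq_size_update[OF this, of \<nu>] \<nu>(3) show "seq_size ls = seq_size (ls[Suc j := \<nu>]) + 1"
      by simp
  qed
qed

lemma graph_flip_pure:
  assumes "graph_flip d (dimers d (state ls)) M'" and ls: "ls \<in> pure_seqs d" and "d \<noteq> []"
  obtains ls' where "ls' \<in> pure_seqs d" "M' = dimers d (state ls')" "seq_size ls' \<le> seq_size ls + 1"
proof -
  have "admissible d (state ls)" using ls by (simp add: pure_seqs_iff)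
  from assms(1) this assms(3) show ?thesis
  proof (cases rule: graph_flipE)
    case (1 j c)
    from pure_raise[OF ls 1(1,2)] obtain ls' where "ls' \<in> pure_seqs d"
      "state ls' = (state ls)((Suc j, c) := state ls (Suc j, c) + 1)" "seq_size ls' = seq_size ls + 1" .
    with 1(3) show ?thesis by (intro that[of ls']) simp_all
  next
    case (2 j c)
    from pure_lower[OF ls 2(1,2)] obtain ls' where "ls' \<in> pure_seqs d"
      "state ls' = (state ls)((Suc j, c) := state ls (Suc j, c) - 1)" "seq_size ls = seq_size ls' + 1" .
    with 2(3) show ?thesis by (intro that[of ls']) simp_all
  qed
qed

text \<open>The heights can be read off from left to right: the first partition is empty, and the
  edges \<open>Same\<close>, never reversed, show by how much each height differs from the one at
  the same content in the previous column.\<close>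

lemma dimers_state_inj: "inj_on (\<lambda>ls. dimers d (state ls)) (pure_seqs d)"
proof (rule inj_onI)
  fix ls ls' assume ls: "ls \<in> pure_seqs d" "ls' \<in> pure_seqs d"
    and eq: "dimers d (state ls) = dimers d (state ls')"
  have N: "admissible d (state ls)" "admissible d (state ls')" using ls by (simp_all add: pure_seqs_iff)
  have cov: "covered d (state ls) e \<longleftrightarrow> covered d (state ls') e" if "edge_ok d e" for e
    using eq seg_in_dimers[OF that] by metis
  have "\<forall>c. state ls (i, c) = state ls' (i, c)" if "i \<le> length d" for i
    using that
  proof (induction i)
    case 0
    show ?case using ls by (simp add: pure_seqs_iff state_def)
  next
    case (Suc j)
    show ?case
    proof
      fix c
      have j: "j < length d" using Suc.prems by simp
      have "state ls (j, c) = state ls' (j, c)" using Suc by simp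
      with cov[of "Same j c"] admissibleD(3)[OF N(1) j, of c] admissibleD(3)[OF N(2) j, of c] j
      show "state ls (Suc j, c) = state ls' (Suc j, c)"
        by (cases "growing (d ! j)") (simp_all add: covered_def, linarith+)
    qed
  qed
  then have "ls ! i = ls' ! i" if "i \<le> length d" for i
    using that ls by (intro beads_above_inject) (auto simp: partition_nth state_def)
  then show "ls = ls'"
    using ls by (intro nth_equalityI) (auto simp: pure_seqs_iff)
qed

lemma seq_size_eq_0:
  assumes "ls \<in> pure_seqs d" "seq_size ls = 0"
  shows "ls = replicate (Suc (length d)) empty_partition"
proof (rule nth_equalityI)
  show "length ls = length (replicate (Suc (length d)) empty_partition)"
    using assms by (simp add: pure_seqs_iff)
  fix i assume i: "i < length ls"
  then have "partition_size (ls ! i) = 0" using assms(2) by (simp add: seq_size_def)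
  moreover have "is_partition (ls ! i)" using assms(1) i by (simp add: pure_seqs_iff)
  ultimately have "ls ! i = empty_partition"
    by (auto simp: partition_size_def is_partition_def empty_partition_def fun_eq_iff)
  then show "ls ! i = replicate (Suc (length d)) empty_partition ! i"
    using i assms(1) by (simp add: pure_seqs_iff del: replicate_Suc)
qed

lemma empty_seq_pure: "replicate (Suc (length d)) empty_partition \<in> pure_seqs d"
proof -
  have "interlaces x empty_partition empty_partition" for x
    by (cases x) (simp_all add: hstrip_def vstrip_def)
  then show ?thesis
    by (subst pure_seqs_iff, subst admissible_state_iff) (auto simp del: replicate_Suc simp: nth_replicate)
qed

text \<open>Removing a box from a largest part, in the last row in which this value occurs, can only clash with
  a neighbouring partition that has the same part in this row and is required to be the smaller one.
  Moving from neighbour to neighbour in this way never turns back, hence ends at a removable box.\<close>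

lemma ex_removable_box:
  assumes ls: "ls \<in> pure_seqs d" and "seq_size ls \<noteq> 0"
  obtains j t v where "Suc j < length d" "(ls ! Suc j) t = Suc v" "(ls ! Suc j) (Suc t) \<le> v"
    "(ls ! j) t \<le> Suc v" "(ls ! j) (Suc t) \<le> v" "growing (d ! j) \<longrightarrow> (ls ! j) t \<le> v"
    "(ls ! Suc (Suc j)) t \<le> Suc v" "(ls ! Suc (Suc j)) (Suc t) \<le> v"
    "\<not> growing (d ! Suc j) \<longrightarrow> (ls ! Suc (Suc j)) t \<le> v"
proof -
  let ?k = "length d"
  have len: "length ls = Suc ?k" and ends: "ls ! 0 = empty_partition" "ls ! ?k = empty_partition"
    using ls by (simp_all add: pure_seqs_iff)
  have part: "is_partition (ls ! i)" if "i \<le> ?k" for i using ls that by (rule partition_nth)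
  define w where "w = Max ((\<lambda>i. (ls ! i) 0) ` {..?k})"
  have le_w: "(ls ! i) t \<le> w" if "i \<le> ?k" for i t
  proof -
    have "(ls ! i) t \<le> (ls ! i) 0" using part[OF that] by (simp add: partition_antimono)
    also have "\<dots> \<le> w" unfolding w_def using that by (intro Max_ge) auto
    finally show ?thesis .
  qed
  have "w \<in> (\<lambda>i. (ls ! i) 0) ` {..?k}" unfolding w_def by (intro Max_in) auto
  then obtain i0 where i0: "i0 \<le> ?k" "(ls ! i0) 0 = w" by auto
  have "w \<noteq> 0"
  proof
    assume "w = 0"
    then have "partition_size (ls ! i) = 0" if "i < length ls" for i
      using le_w[of i] that len by (simp add: partition_size_def)
    with assms(2) show False by (simp add: seq_size_def)
  qed
  then obtain v where v: "w = Suc v" using not0_implies_Suc by blast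
  define T where "T = {t. \<exists>i\<le>?k. (ls ! i) t = w}"
  have "T \<subseteq> (\<Union>i\<le>?k. {t. (ls ! i) t \<noteq> 0})" using \<open>w \<noteq> 0\<close> by (auto simp: T_def)
  moreover have "finite (\<Union>i\<le>?k. {t. (ls ! i) t \<noteq> 0})"
    using part by (auto simp: is_partition_def)
  ultimately have "finite T" by (rule finite_subset)
  have "0 \<in> T" using i0 by (auto simp: T_def)
  define t where "t = Max T"
  have "t \<in> T" unfolding t_def using \<open>finite T\<close> \<open>0 \<in> T\<close> by (intro Max_in) auto
  have "Suc t \<notin> T"
    using Max_ge[OF \<open>finite T\<close>, of "Suc t"] by (auto simp: t_def)
  then have next_le: "(ls ! i) (Suc t) \<le> v" if "i \<le> ?k" for i
    using le_w[OF that, of "Suc t"] that by (force simp: T_def v)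
  define S where "S = {i. i \<le> ?k \<and> (ls ! i) t = w}"
  \<comment> \<open>\<open>good i\<close> says that the right neighbour does not prevent removing
    the box. At the smallest good index the left neighbour does not either: if it did, it would lie
    in S before a growing symbol and so be good itself.\<close>
  define good where "good i \<longleftrightarrow> i \<in> S \<and> (Suc i \<in> S \<longrightarrow> growing (d ! i))" for i
  have "finite S" by (simp add: S_def)
  moreover have "S \<noteq> {}" using \<open>t \<in> T\<close> by (auto simp: T_def S_def)
  ultimately have "Max S \<in> S" by (rule Max_in)
  moreover have "Suc (Max S) \<notin> S" using Max_ge[OF \<open>finite S\<close>, of "Suc (Max S)"] by auto
  ultimately have "good (Max S)" by (simp add: good_def)
  define i where "i = (LEAST i. good i)"
  have good_i: "good i" unfolding i_def by (rule LeastI[of good]) fact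
  then have iS: "i \<le> ?k" "(ls ! i) t = Suc v" by (auto simp: good_def S_def v)
  have "i \<noteq> 0" "i \<noteq> ?k"
    using iS(2) ends by (intro notI; simp add: empty_partition_def)+
  then obtain j where ij: "i = Suc j" using not0_implies_Suc by blast
  have j: "Suc j < ?k" using iS(1) \<open>i \<noteq> ?k\<close> ij by simp
  have "\<not> good j" using not_less_Least[of j good] ij unfolding i_def by simp
  show ?thesis
  proof (rule that[of j t v])
    show "Suc j < ?k" by fact
    show "(ls ! Suc j) t = Suc v" using iS ij by simp
    show "(ls ! Suc j) (Suc t) \<le> v" "(ls ! j) (Suc t) \<le> v" "(ls ! Suc (Suc j)) (Suc t) \<le> v"
      using next_le j by simp_all
    show "(ls ! j) t \<le> Suc v" "(ls ! Suc (Suc j)) t \<le> Suc v"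
      using le_w j by (simp_all add: v)
    show "growing (d ! j) \<longrightarrow> (ls ! j) t \<le> v"
    proof
      assume "growing (d ! j)"
      then have "j \<notin> S" using \<open>\<not> good j\<close> by (auto simp: good_def)
      then show "(ls ! j) t \<le> v" using le_w[of j t] j by (simp add: S_def v)
    qed
    show "\<not> growing (d ! Suc j) \<longrightarrow> (ls ! Suc (Suc j)) t \<le> v"
    proof
      assume "\<not> growing (d ! Suc j)"
      then have "Suc (Suc j) \<notin> S" using good_i by (auto simp: good_def ij)
      then show "(ls ! Suc (Suc j)) t \<le> v" using le_w[of "Suc (Suc j)" t] j by (simp add: S_def v)
    qed
  qed
qed

lemma graph_flip_down:
  assumes ls: "ls \<in> pure_seqs d" and "seq_size ls \<noteq> 0"
  obtains ls' where "ls' \<in> pure_seqs d" "graph_flip d (dimers d (state ls')) (dimers d (state ls))"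
    "seq_size ls = seq_size ls' + 1"
proof -
  from ex_removable_box[OF assms] obtain j t v where j: "Suc j < length d"
    and v: "(ls ! Suc j) t = Suc v" "(ls ! Suc j) (Suc t) \<le> v"
    and l: "(ls ! j) t \<le> Suc v" "(ls ! j) (Suc t) \<le> v" "growing (d ! j) \<longrightarrow> (ls ! j) t \<le> v"
    and r: "(ls ! Suc (Suc j)) t \<le> Suc v" "(ls ! Suc (Suc j)) (Suc t) \<le> v"
      "\<not> growing (d ! Suc j) \<longrightarrow> (ls ! Suc (Suc j)) t \<le> v" .
  define \<mu> where "\<mu> = ls ! Suc j"
  define \<nu> where "\<nu> = \<mu>(t := v)"
  define ls' where "ls' = ls[Suc j := \<nu>]"
  have len: "length ls = Suc (length d)" and part: "\<forall>\<mu>\<in>set ls. is_partition \<mu>"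
    and ends: "ls ! 0 = empty_partition" "ls ! length d = empty_partition"
    and N: "admissible d (state ls)"
    using ls by (simp_all add: pure_seqs_iff)
  have part_l: "is_partition (ls ! j)" and part_r: "is_partition (ls ! Suc (Suc j))" and part_\<mu>: "is_partition \<mu>"
    using ls j by (simp_all add: partition_nth \<mu>_def)
  have part_\<nu>: "is_partition \<nu>" unfolding \<nu>_def
  proof (rule is_partition_upd[OF part_\<mu>])
    show "\<mu> (Suc t) \<le> v" using v by (simp add: \<mu>_def)
    show "v \<le> \<mu> s" if "t = Suc s" for s
      using partition_Suc_le[OF part_\<mu>, of s] that v by (simp add: \<mu>_def)
  qed
  have \<mu>: "\<mu> = \<nu>(t := Suc (\<nu> t))" using v by (auto simp: \<nu>_def \<mu>_def fun_eq_iff)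
  have inter: "\<forall>i<length d. interlaces (d ! i) (ls ! i) (ls ! Suc i)"
    using admissible_state_iff[OF len part] N by simp
  then have "interlaces (d ! j) (ls ! j) \<mu>" "interlaces (d ! Suc j) \<mu> (ls ! Suc (Suc j))"
    using j by (simp_all add: \<mu>_def)
  have left: "interlaces (d ! j) (ls ! j) \<nu>"
    unfolding \<nu>_def using part_l part_\<mu> part_\<nu>[unfolded \<nu>_def] \<open>interlaces (d ! j) (ls ! j) \<mu>\<close>
      v(1)[folded \<mu>_def] l by (rule interlaces_remove_box_right)
  have right: "interlaces (d ! Suc j) \<nu> (ls ! Suc (Suc j))"
    unfolding \<nu>_def using part_r part_\<mu> part_\<nu>[unfolded \<nu>_def]
      \<open>interlaces (d ! Suc j) \<mu> (ls ! Suc (Suc j))\<close> v(1)[folded \<mu>_def] r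
    by (rule interlaces_remove_box_left)
  have len': "length ls' = Suc (length d)" and part': "\<forall>\<mu>\<in>set ls'. is_partition \<mu>"
    using len part part_\<nu> set_update_subset_insert[of ls "Suc j" \<nu>] by (auto simp: ls'_def)
  have "interlaces (d ! i) (ls' ! i) (ls' ! Suc i)" if "i < length d" for i
  proof -
    consider "i = j" | "i = Suc j" | "i \<noteq> j" "i \<noteq> Suc j" by blast
    then show ?thesis
      using left right inter that j len by cases (simp_all add: ls'_def)
  qed
  then have N': "admissible d (state ls')"
    using admissible_state_iff[OF len' part'] by simp
  have ls'_pure: "ls' \<in> pure_seqs d"
    unfolding pure_seqs_iff using len' part' N' ends j by (simp add: ls'_def)
  define c where "c = int (\<nu> t) - int t"
  have "beads_above \<mu> = (beads_above \<nu>)(c := beads_above \<nu> c + 1)"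
    by (subst \<mu>) (simp add: c_def beads_above_add_box[OF part_\<nu>])
  moreover have "ls = ls'[Suc j := \<mu>]" by (simp add: ls'_def \<mu>_def)
  moreover have nth: "ls' ! Suc j = \<nu>" using j len by (simp add: ls'_def)
  ultimately have st: "state ls = (state ls')((Suc j, c) := state ls' (Suc j, c) + 1)"
    using state_update[of "Suc j" ls' \<mu> c "beads_above \<nu> c + 1"] j len' by (simp add: state_def)
  show ?thesis
  proof (rule that)
    show "ls' \<in> pure_seqs d" by fact
    show "graph_flip d (dimers d (state ls')) (dimers d (state ls))"
      using graph_flip_raise(1)[OF j refl N'] N unfolding st by blast
    have "partition_size \<mu> = partition_size \<nu> + 1"
      by (subst \<mu>) (simp add: partition_size_upd_Suc[OF part_\<nu>])
    then show "seq_size ls = seq_size ls' + 1"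
      using seq_size_update[of "Suc j" ls \<nu>] j len by (simp add: ls'_def \<mu>_def)
  qed
qed

section \<open>Counting flips from the matching of the empty sequence\<close>

abbreviation "start \<equiv> dimers d (state (replicate (Suc (length d)) empty_partition))"

lemma graph_flips_to_pure:
  assumes "ls \<in> pure_seqs d"
  shows "(graph_flip d ^^ seq_size ls) start (dimers d (state ls))"
  using assms
proof (induction "seq_size ls" arbitrary: ls)
  case 0
  then show ?case using seq_size_eq_0 by simp
next
  case (Suc n)
  from Suc.hyps(2) Suc.prems obtain ls' where ls': "ls' \<in> pure_seqs d"
    "graph_flip d (dimers d (state ls')) (dimers d (state ls))" "seq_size ls = seq_size ls' + 1"
    by (metis graph_flip_down nat.distinct(1))
  with Suc.hyps have "(graph_flip d ^^ seq_size ls') start (dimers d (state ls'))" by simp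
  from relpowp_Suc_I[OF this ls'(2)] ls'(3) show ?case by simp
qed

text \<open>A flip adds or removes one box, so the size grows by at most one per flip. This gives
  the lower bound for the distance, and also shows that flips never leave the matchings of pure
  sequences.\<close>

lemma graph_flips_from_empty:
  assumes "(graph_flip d ^^ n) start M'" and "d \<noteq> []"
  shows "\<exists>ls\<in>pure_seqs d. M' = dimers d (state ls) \<and> seq_size ls \<le> n"
  using assms(1)
proof (induction n arbitrary: M')
  case 0
  have "seq_size (replicate (Suc (length d)) empty_partition) = 0"
    by (simp add: seq_size_def partition_size_def empty_partition_def nth_replicate del: replicate_Suc)
  with 0 empty_seq_pure show ?case by auto
next
  case (Suc n)
  then obtain M where "(graph_flip d ^^ n) start M" and M: "graph_flip d M M'"
    by (auto elim: relpowp_Suc_E)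
  with Suc.IH obtain ls where ls: "ls \<in> pure_seqs d" "M = dimers d (state ls)" "seq_size ls \<le> n" by blast
  from M have "graph_flip d (dimers d (state ls)) M'" unfolding ls(2) .
  from this ls(1) assms(2) obtain ls' where "ls' \<in> pure_seqs d" "M' = dimers d (state ls')"
    "seq_size ls' \<le> seq_size ls + 1" by (rule graph_flip_pure)
  with ls(3) show ?case by force
qed

lemma infinite_vertices:
  assumes "d \<noteq> []"
  shows "infinite (grid_vertices (graph_edges d))"
proof -
  have "grid_point (xpos d 0) y \<in> \<Union>(graph_edges d)" for y
    using assms by (intro line_covered[of _ d 0]) (simp_all add: grid_point_def)
  then have "range (grid_point (xpos d 0)) \<subseteq> grid_vertices (graph_edges d)"
    by (auto simp: grid_vertices_def)
  moreover have "infinite (range (grid_point (xpos d 0)))"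
    using infinite_UNIV_char_0[where ?'a = int] by (auto dest!: finite_imageD intro: injI)
  ultimately show ?thesis using finite_subset by blast
qed

text \<open>If n flips suffice, they end at the matching of some pure sequence of size at most n,
  which by injectivity is ls itself.\<close>

lemma flip_distance_dimers:
  assumes "ls \<in> pure_seqs d" "d \<noteq> []"
  shows "flip_distance (grid_vertices (graph_edges d)) (graph_edges d) start (dimers d (state ls)) =
    seq_size ls"
  unfolding flip_distance_def graph_flip_def[symmetric]
proof (rule Least_equality)
  show "(graph_flip d ^^ seq_size ls) start (dimers d (state ls))"
    using assms(1) by (rule graph_flips_to_pure)
  fix n assume "(graph_flip d ^^ n) start (dimers d (state ls))"
  with graph_flips_from_empty assms(2) obtain ls' where
    "ls' \<in> pure_seqs d" "dimers d (state ls) = dimers d (state ls')" "seq_size ls' \<le> n" by blast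
  with assms(1) show "seq_size ls \<le> n" using inj_onD[OF dimers_state_inj] by blast
qed

lemma flip_reachable_dimers:
  assumes "d \<noteq> []"
  shows "flip_reachable (grid_vertices (graph_edges d)) (graph_edges d) start =
    (\<lambda>ls. dimers d (state ls)) ` pure_seqs d"
  unfolding flip_reachable_def graph_flip_def[symmetric] rtranclp_power
  using graph_flips_to_pure graph_flips_from_empty assms by blast

end

theorem theorem13:
  fixes k :: nat and d :: "interlacing list"
  assumes "k \<ge> 1" and "length d = k"
  shows "\<exists>V E m. plane_graph V E \<and> bipartite V E \<and> infinite V \<and> matching E m \<and>
    (\<exists>\<phi>. bij_betw \<phi> (pure_seqs d) (flip_reachable V E m) \<and>
      (\<forall>ls\<in>pure_seqs d. flip_distance V E m (\<phi> ls) = (\<Sum>i=0..k. partition_size (ls ! i))))"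
proof -
  let ?E = "graph_edges d" and ?V = "grid_vertices (graph_edges d)"
  let ?m = "dimers d (state (replicate (Suc (length d)) empty_partition))"
  let ?\<phi> = "\<lambda>ls. dimers d (state ls)"
  have d: "d \<noteq> []" using assms by auto
  have m: "matching ?E ?m"
    using empty_seq_pure[of d] by (intro matching_dimers) (simp add: pure_seqs_iff)
  have bij: "bij_betw ?\<phi> (pure_seqs d) (flip_reachable ?V ?E ?m)"
    unfolding bij_betw_def using dimers_state_inj[of d] flip_reachable_dimers[OF d] by blast
  have "flip_distance ?V ?E ?m (?\<phi> ls) = (\<Sum>i=0..k. partition_size (ls ! i))" if "ls \<in> pure_seqs d" for ls
  proof -
    have "{..<length ls} = {0..k}" using that assms(2) by (auto simp: pure_seqs_iff)
    then show ?thesis using flip_distance_dimers[OF that d] by (simp add: seq_size_def)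
  qed
  with plane_graph_grid[OF graph_edges_grid] bipartite_grid[OF graph_edges_grid] infinite_vertices[OF d] m bij
  show ?thesis by (intro exI[of _ ?V] exI[of _ ?E] exI[of _ ?m] exI[of _ ?\<phi>] conjI ballI)
qed

end
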